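(* Let $R\in\mathbb{R}$, and let $n,k\in\mathbb{N}$ be relatively prime with $1\le k<n/2$. Put $\alpha=2\pi k/n$, and for $\beta\in\mathbb{R}$ put $\beta'=\beta-\tfrac12\alpha$, normalised so that $\pi-2\pi/n<\beta'\le\pi$. Let $\nu\in\mathbb{C}$, $|\nu|=1$. (1) If $R<\cos(\pi/n)\sec(\pi k/n)$, there are no $T^2$-type representations $\Psi(R,n,k,\beta,\nu)$. (2) If $\cos(\pi/n)\sec(\pi k/n)<R\le\sec(\pi k/n)$, there exists a one-parameter set of $T^2$-type representations $\Psi(R,n,k,\beta,\nu)$ with $\beta$ in the range $$\pi-\frac{2\pi}{n}+\tfrac12\delta<\beta'<\pi-\tfrac12\delta,\qquad\text{where }\cos(\tfrac12\delta)=R\cos(\pi k/n),\ 0\le\delta<2\pi/n.$$ (3) If $R>\sec(\pi k/n)$, there exists a one-parameter set of irreducible $T^2$-type representations $\Psi(R,n,k,\beta,\nu)$ with the full range of $\beta$, i.e. $\pi-2\pi/n<\beta'\le\pi$.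
   Context: For $R\in\mathbb{R}$, $\mathcal{A}(R)$ is the unital associative complex algebra generated by $\mathbf{x},\mathbf{y},\mathbf{z},\boldsymbol{\varepsilon},(1+\boldsymbol{\varepsilon}^2)^{-1}$, where $\boldsymbol{\varepsilon}$ is central and $(1+\boldsymbol{\varepsilon}^2)^{-1}$ is the inverse of $1+\boldsymbol{\varepsilon}^2$, subject to $[\mathbf{x},\mathbf{y}]=i\boldsymbol{\varepsilon}\mathbf{z}$, $[\mathbf{y},\mathbf{z}]=i\boldsymbol{\varepsilon}(\mathbf{w}\mathbf{x}+\mathbf{x}\mathbf{w})$, $[\mathbf{z},\mathbf{x}]=i\boldsymbol{\varepsilon}(\mathbf{w}\mathbf{y}+\mathbf{y}\mathbf{w})$, $\mathbf{z}^2+\mathbf{w}^2=1$, where $\mathbf{w}:=\mathbf{x}^2+\mathbf{y}^2-R$. It carries the conjugate-linear anti-multiplicative involution $\dagger$ fixing $\mathbf{x},\mathbf{y},\mathbf{z},\boldsymbol{\varepsilon}$. Put $\mathbf{u}:=\mathbf{w}+i\mathbf{z}$, $\mathbf{a}_\pm:=\mathbf{x}\pm i\mathbf{y}$. Representations considered: irreducible $\Psi:\mathcal{A}(R)\to\mathcal{L}(\mathcal{H},\mathcal{H})$ (linear maps on $\mathcal{H}$), where $\mathcal{H}$ is an $n$-dimensional complex Hilbert space, with $\Psi(\mathbf{f}^\dagger)=\Psi(\mathbf{f})^\dagger$ for all $\mathbf f$, $\Psi(\boldsymbol{\varepsilon})=\varepsilon\,\mathrm{Id}$ for some real $\varepsilon>0$,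 and $\Psi(\mathbf{u})$ having no multiple eigenvalues; $\alpha\in(0,\pi)$ is defined by $\tan(\tfrac12\alpha)=\varepsilon$. Such a $\Psi$ is a $T^2$-type representation $\Psi(R,n,k,\beta,\nu)$, where $1\le k<n/2$, $\gcd(n,k)=1$, $\beta\in\mathbb{R}$, $|\nu|=1$, if $\alpha=2\pi k/n$ and there are an orthonormal basis $|\beta+m\alpha\rangle$, $m=0,\dots,n-1$, of $\mathcal{H}$ and nonzero constants $C_{\beta+m\alpha}\in\mathbb{C}$, $m=0,\dots,n-1$, with $|C_{\beta+m\alpha}|^2=\sec(\tfrac12\alpha)\cos(\beta-\tfrac12\alpha+m\alpha)+R$, such that (writing $\mathbf{f}$ for $\Psi(\mathbf{f})$) $\mathbf{u}|\beta+m\alpha\rangle=e^{i(\beta+m\alpha)}|\beta+m\alpha\rangle$ for $0\le m\le n-1$; $\mathbf{a}_-|\beta+m\alpha\rangle=C_{\beta+m\alpha}|\beta+(m-1)\alpha\rangle$ for $1\le m\le n-1$; $\mathbf{a}_+|\beta+m\alpha\rangle=\overline{C_{\beta+(m+1)\alpha}}|\beta+(m+1)\alpha\rangle$ for $0\le m\le n-2$; $\mathbf{a}_-|\beta\rangle=C_\beta|\beta+(n-1)\alpha\rangle$ and $\mathbf{a}_+|\beta+(n-1)\alpha\rangle=\overline{C_\beta}|\beta\rangle$; and $\nu=C_{\mathrm{prod}}/|C_{\mathrm{prod}}|$ with $C_{\mathrm{prod}}=\prod_{m=0}^{n-1}C_{\beta+m\alpha}$. Up to equivalence $\beta$ may be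 normalised so that $\pi-2\pi/n<\beta-\tfrac12\alpha\le\pi$. *)

theory Defs
  imports Complex_Main "HOL-Library.Poly_Mapping" "HOL-Algebra.QuotRing"
    "HOL-Computational_Algebra.Polynomial"
begin

section \<open>The algebra and its involution\<close>

text \<open>The free algebra is the monoid algebra of the free monoid on the five generators;
  \<open>GInv\<close> stands for the inverse of \<open>1 + GEps\<^sup>2\<close>. Words are wrapped in a type of their
  own so that concatenation can be the \<open>+\<close> that \<open>Poly_Mapping\<close> convolves along.\<close>

datatype generator = GX | GY | GZ | GEps | GInv

datatype word = Word (letters: "generator list")

instantiation word :: monoid_add
begin

definition zero_word :: word where "0 = Word []"

definition plus_word :: "word \<Rightarrow> word \<Rightarrow> word" where
  "v + w = Word (letters v @ letters w)"

instance
  by standard (simp_all add: zero_word_def plus_word_def)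

end

type_synonym free_alg = "word \<Rightarrow>\<^sub>0 complex"

definition const :: "complex \<Rightarrow> free_alg" where
  "const c = Poly_Mapping.single 0 c"

definition gen :: "generator \<Rightarrow> free_alg" where
  "gen g = Poly_Mapping.single (Word [g]) 1"

definition w_free :: "real \<Rightarrow> free_alg" where
  "w_free R = gen GX ^ 2 + gen GY ^ 2 - const (of_real R)"

definition relators :: "real \<Rightarrow> free_alg set" where
  "relators R =
    range (\<lambda>g. gen GEps * gen g - gen g * gen GEps) \<union>
    {(1 + gen GEps ^ 2) * gen GInv - 1,
     gen GInv * (1 + gen GEps ^ 2) - 1,
     (gen GX * gen GY - gen GY * gen GX) - const \<i> * gen GEps * gen GZ,
     (gen GY * gen GZ - gen GZ * gen GY)
       - const \<i> * gen GEps * (w_free R * gen GX + gen GX * w_free R),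
     (gen GZ * gen GX - gen GX * gen GZ)
       - const \<i> * gen GEps * (w_free R * gen GY + gen GY * w_free R),
     gen GZ ^ 2 + w_free R ^ 2 - 1}"

definition free_ring :: "free_alg ring" where
  "free_ring = \<lparr>carrier = UNIV, monoid.mult = (*), one = 1, ring.zero = 0, add = (+)\<rparr>"

definition rel_ideal :: "real \<Rightarrow> free_alg set" where
  "rel_ideal R = genideal free_ring (relators R)"

definition alg :: "real \<Rightarrow> free_alg set ring" where
  "alg R = free_ring Quot rel_ideal R"

definition cls :: "real \<Rightarrow> free_alg \<Rightarrow> free_alg set" where
  "cls R f = rel_ideal R +>\<^bsub>free_ring\<^esub> f"

definition alg_scale :: "real \<Rightarrow> complex \<Rightarrow> free_alg set \<Rightarrow> free_alg set" where
  "alg_scale R c F = cls R (const c) \<otimes>\<^bsub>alg R\<^esub> F"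

definition eps :: "real \<Rightarrow> free_alg set" where
  "eps R = cls R (gen GEps)"

definition u_elt :: "real \<Rightarrow> free_alg set" where
  "u_elt R = cls R (w_free R + const \<i> * gen GZ)"

definition a_plus :: "real \<Rightarrow> free_alg set" where
  "a_plus R = cls R (gen GX + const \<i> * gen GY)"

definition a_minus :: "real \<Rightarrow> free_alg set" where
  "a_minus R = cls R (gen GX - const \<i> * gen GY)"

definition rev_word :: "word \<Rightarrow> word" where
  "rev_word w = Word (rev (letters w))"

definition star :: "free_alg \<Rightarrow> free_alg" where
  "star f = Poly_Mapping.map cnj (Poly_Mapping.map_key rev_word f)"

text \<open>On the quotient the involution acts by taking the image of a coset; see
  \<open>dagger_cls\<close> below.\<close>

definition dagger :: "free_alg set \<Rightarrow> free_alg set" where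
  "dagger F = star ` F"

lemma rev_word_simps [simp]:
  "rev_word (rev_word w) = w" "rev_word 0 = 0" "rev_word (Word [g]) = Word [g]"
  "rev_word (v + w) = rev_word w + rev_word v"
  by (simp_all add: rev_word_def zero_word_def plus_word_def)

lemma inj_rev_word: "inj rev_word"
  by (metis injI rev_word_simps(1))

lemma lookup_star:
  "Poly_Mapping.lookup (star f) w = cnj (Poly_Mapping.lookup f (rev_word w))"
  by (simp add: star_def Poly_Mapping.map.rep_eq map_key.rep_eq inj_rev_word when_def)

lemma star_single: "star (Poly_Mapping.single w c) = Poly_Mapping.single (rev_word w) (cnj c)"
  by (rule poly_mapping_eqI) (auto simp: lookup_star lookup_single when_def)

lemma star_add: "star (f + g) = star f + star g"
  by (rule poly_mapping_eqI) (simp add: lookup_star lookup_add)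

lemma star_minus: "star (f - g) = star f - star g"
  by (rule poly_mapping_eqI) (simp add: lookup_star lookup_minus)

lemma star_star [simp]: "star (star f) = f"
  by (rule poly_mapping_eqI) (simp add: lookup_star)

lemma star_0 [simp]: "star 0 = 0"
  by (rule poly_mapping_eqI) (simp add: lookup_star)

lemma star_const: "star (const c) = const (cnj c)"
  by (simp add: const_def star_single)

lemma star_gen: "star (gen g) = gen g"
  by (simp add: gen_def star_single)

lemma star_1 [simp]: "star 1 = 1"
  using star_const[of 1] by (simp add: const_def)

lemma free_alg_induct [case_names zero add]:
  fixes f :: free_alg
  assumes "P 0" "\<And>f w c. P f \<Longrightarrow> P (f + Poly_Mapping.single w c)"
  shows "P f"
proof (induction f rule: update_induct)
  case const
  then show ?case using assms(1) by simp
next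
  case (update f w c)
  have "Poly_Mapping.update w c f = f + Poly_Mapping.single w c"
    using update by (intro poly_mapping_eqI)
      (auto simp: lookup_update lookup_add lookup_single when_def in_keys_iff)
  then show ?case using assms(2) update by simp
qed

lemma star_mult: "star (f * g) = star g * star f"
proof (induction f rule: free_alg_induct)
  case zero
  then show ?case by simp
next
  case (add f v c)
  have "star (Poly_Mapping.single v c * g) = star g * star (Poly_Mapping.single v c)"
    by (induction g rule: free_alg_induct)
      (simp_all add: distrib_left distrib_right star_add mult_single star_single mult.commute)
  with add show ?case by (simp add: distrib_left distrib_right star_add)
qed

lemma ring_free_ring: "ring free_ring"
proof (rule ringI)
  show "abelian_group free_ring"
    by (rule abelian_groupI) (auto simp: free_ring_def add.assoc add.commute
        intro: exI[of _ "- x" for x] left_minus)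
  show "Group.monoid free_ring"
    by (rule monoidI) (auto simp: free_ring_def mult.assoc)
qed (auto simp: free_ring_def distrib_left distrib_right)

lemma ideal_rel_ideal: "ideal (rel_ideal R) free_ring"
  unfolding rel_ideal_def
  by (rule ring.genideal_ideal[OF ring_free_ring]) (simp add: free_ring_def)

lemma carrier_alg: "carrier (alg R) = range (cls R)"
  by (auto simp: alg_def cls_def FactRing_def A_RCOSETS_def' free_ring_def)

lemma cls_eq: "cls R f = {r + f | r. r \<in> rel_ideal R}"
  by (auto simp: cls_def a_r_coset_def' free_ring_def)

lemma star_w_free: "star (w_free R) = w_free R"
  by (simp add: w_free_def power2_eq_square star_add star_minus star_mult star_gen star_const)

lemma const_commute: "const c * f = f * const c"
  by (induction f rule: free_alg_induct)
    (simp_all add: const_def distrib_left distrib_right mult_single mult.commute)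

lemma const_neg_ii: "const (- \<i>) = - const \<i>"
  by (simp add: const_def single_uminus)

lemma rel_ideal_closed:
  shows "r \<in> rel_ideal R \<Longrightarrow> s \<in> rel_ideal R \<Longrightarrow> r + s \<in> rel_ideal R"
    and "r \<in> rel_ideal R \<Longrightarrow> f * r \<in> rel_ideal R"
    and "r \<in> rel_ideal R \<Longrightarrow> r * f \<in> rel_ideal R"
    and "0 \<in> rel_ideal R"
    and "r \<in> rel_ideal R \<Longrightarrow> - r \<in> rel_ideal R"
    and "r \<in> relators R \<Longrightarrow> r \<in> rel_ideal R"
proof -
  interpret ideal "rel_ideal R" free_ring by (rule ideal_rel_ideal)
  show "r \<in> rel_ideal R \<Longrightarrow> s \<in> rel_ideal R \<Longrightarrow> r + s \<in> rel_ideal R"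
    using additive_subgroup.a_closed[OF additive_subgroup_axioms, of r s] by (simp add: free_ring_def)
  show "r \<in> rel_ideal R \<Longrightarrow> f * r \<in> rel_ideal R" for f r
    using I_l_closed by (simp add: free_ring_def)
  from this[of r "-1"] show "r \<in> rel_ideal R \<Longrightarrow> - r \<in> rel_ideal R" by simp
  show "r \<in> rel_ideal R \<Longrightarrow> r * f \<in> rel_ideal R"
    using I_r_closed by (simp add: free_ring_def)
  show "0 \<in> rel_ideal R"
    using additive_subgroup.zero_closed[OF additive_subgroup_axioms] by (simp add: free_ring_def)
  show "r \<in> relators R \<Longrightarrow> r \<in> rel_ideal R"
    using ring.genideal_self[OF ring_free_ring, of "relators R"]
    by (auto simp: rel_ideal_def free_ring_def)
qed

lemma star_relators: "r \<in> relators R \<Longrightarrow> star r \<in> rel_ideal R"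
proof -
  assume r: "r \<in> relators R"
  have "star r \<in> relators R \<or> - star r \<in> relators R \<or> star r \<in> rel_ideal R"
  proof -
    note st = star_add star_minus star_mult star_gen star_const star_w_free power2_eq_square
      const_neg_ii
    let ?c = "const \<i>" and ?e = "gen GEps"
    have swap: "star (gen a * gen b - gen b * gen a - ?c * ?e * p) \<in> rel_ideal R"
      if m: "gen a * gen b - gen b * gen a - ?c * ?e * p \<in> relators R"
        and p: "star p = p" and com: "p * ?e - ?e * p \<in> rel_ideal R" for a b p
    proof -
      have c: "q * (?c * s) = ?c * (q * s)" for q s
        by (metis const_commute mult.assoc)
      have "star (gen a * gen b - gen b * gen a - ?c * ?e * p)
          = - (gen a * gen b - gen b * gen a - ?c * ?e * p) + ?c * (p * ?e - ?e * p)"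
        by (simp add: st p c const_commute[symmetric] algebra_simps mult.assoc)
      then show ?thesis
        using rel_ideal_closed m com by metis
    qed
    have ctr: "f * ?e - ?e * f \<in> rel_ideal R" for f
    proof (induction f rule: free_alg_induct)
      case zero
      then show ?case by (simp add: rel_ideal_closed)
    next
      case (add f w c)
      have "Poly_Mapping.single (Word l) 1 * ?e - ?e * Poly_Mapping.single (Word l) 1
          \<in> rel_ideal R" for l
      proof (induction l)
        case Nil
        have "Poly_Mapping.single (Word []) 1 = (1 :: free_alg)"
          by (simp add: zero_word_def[symmetric])
        then show ?case by (simp add: rel_ideal_closed)
      next
        case (Cons g l)
        let ?l = "Poly_Mapping.single (Word l) 1 :: free_alg"
        have s: "Poly_Mapping.single (Word (g # l)) 1 = gen g * ?l"
          by (simp add: gen_def mult_single plus_word_def)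
        have "gen g * ?l * ?e - ?e * (gen g * ?l)
            = gen g * (?l * ?e - ?e * ?l) + - (?e * gen g - gen g * ?e) * ?l"
          by (simp add: algebra_simps)
        moreover have "?e * gen g - gen g * ?e \<in> relators R"
          by (auto simp: relators_def)
        ultimately show ?case
          unfolding s using Cons rel_ideal_closed by metis
      qed
      from this[of "letters w"] have 1: "Poly_Mapping.single w 1 * ?e - ?e * Poly_Mapping.single w 1
          \<in> rel_ideal R" by simp
      have s: "Poly_Mapping.single w c = const c * Poly_Mapping.single w 1"
        by (simp add: const_def mult_single)
      have "(f + Poly_Mapping.single w c) * ?e - ?e * (f + Poly_Mapping.single w c)
        = (f * ?e - ?e * f) +
          const c * (Poly_Mapping.single w 1 * ?e - ?e * Poly_Mapping.single w 1)"
        unfolding s by (simp add: algebra_simps) (metis const_commute mult.assoc)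
      then show ?case using 1 add rel_ideal_closed by metis
    qed
    have sc: "star (?e * gen g - gen g * ?e) = - (?e * gen g - gen g * ?e)" for g
      by (simp add: st)
    show ?thesis
      using r unfolding relators_def
      apply (elim UnE insertE emptyE rangeE)
      subgoal using r by (simp only: sc relators_def) auto
      subgoal by (simp add: st)
      subgoal by (simp add: st)
      subgoal using swap[of GX GY "gen GZ"] ctr by (simp add: star_gen relators_def)
      subgoal using swap[of GY GZ "w_free R * gen GX + gen GX * w_free R"] ctr
        by (simp add: st relators_def)
      subgoal using swap[of GZ GX "w_free R * gen GY + gen GY * w_free R"] ctr
        by (simp add: st relators_def)
      subgoal by (simp add: st)
      done
  qed
  then show ?thesis
    using rel_ideal_closed by (metis minus_minus)
qed

lemma star_rel_ideal: "r \<in> rel_ideal R \<Longrightarrow> star r \<in> rel_ideal R"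
proof -
  have "ideal {r. star r \<in> rel_ideal R} free_ring"
  proof (rule idealI[OF ring_free_ring])
    show "subgroup {r. star r \<in> rel_ideal R} (add_monoid free_ring)"
    proof (rule group.subgroupI)
      show "Group.group (add_monoid free_ring)"
        using ring.is_abelian_group[OF ring_free_ring] abelian_group.a_group by blast
      fix a assume a: "a \<in> {r. star r \<in> rel_ideal R}"
      have "inv\<^bsub>add_monoid free_ring\<^esub> a = - a"
        using abelian_group.minus_equality[OF ring.is_abelian_group[OF ring_free_ring], of "- a" a]
        by (simp add: free_ring_def a_inv_def)
      then show "inv\<^bsub>add_monoid free_ring\<^esub> a \<in> {r. star r \<in> rel_ideal R}"
        using a rel_ideal_closed(5)[of "star a"] star_minus[of 0 a] by simp
    qed (auto simp: free_ring_def star_add rel_ideal_closed intro!: exI[of _ 0])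
  qed (auto simp: free_ring_def star_mult rel_ideal_closed)
  then have "rel_ideal R \<subseteq> {r. star r \<in> rel_ideal R}"
    unfolding rel_ideal_def
    by (intro ring.genideal_minimal[OF ring_free_ring])
      (auto simp: star_relators rel_ideal_def[symmetric])
  then show "r \<in> rel_ideal R \<Longrightarrow> star r \<in> rel_ideal R" by auto
qed

lemma dagger_cls: "dagger (cls R f) = cls R (star f)"
proof -
  have "star ` rel_ideal R = rel_ideal R"
  proof (intro antisym subsetI)
    fix r assume "r \<in> rel_ideal R"
    then show "r \<in> star ` rel_ideal R"
      by (intro image_eqI[of _ _ "star r"]) (simp_all add: star_rel_ideal)
  qed (auto simp: star_rel_ideal)
  moreover have "dagger (cls R f) = (\<lambda>r. r + star f) ` star ` rel_ideal R"
    by (simp add: dagger_def cls_eq Setcompr_eq_image image_image star_add)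
  ultimately show ?thesis
    by (simp add: cls_eq Setcompr_eq_image)
qed

section \<open>Finite-dimensional Hilbert spaces\<close>

text \<open>The space is a subspace of an ambient complex vector space, so that its dimension is a
  value and not tied to a type; nothing outside the carrier matters. Completeness is automatic in
  finite dimension. The inner product is conjugate-linear in its first argument.\<close>

record 'h hspace =
  vecs :: "'h set"
  scale :: "complex \<Rightarrow> 'h \<Rightarrow> 'h"
  inner :: "'h \<Rightarrow> 'h \<Rightarrow> complex"

definition hilbert_space_dim :: "('h::ab_group_add) hspace \<Rightarrow> nat \<Rightarrow> bool" where
  "hilbert_space_dim H n \<longleftrightarrow>
    vector_space (scale H) \<and>
    module.subspace (scale H) (vecs H) \<and>
    (\<exists>B. finite B \<and> module.span (scale H) B = vecs H) \<and>
    vector_space.dim (scale H) (vecs H) = n \<and>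
    (\<forall>u\<in>vecs H. \<forall>v\<in>vecs H. \<forall>w\<in>vecs H. inner H u (v + w) = inner H u v + inner H u w) \<and>
    (\<forall>u\<in>vecs H. \<forall>v\<in>vecs H. \<forall>c. inner H u (scale H c v) = c * inner H u v) \<and>
    (\<forall>u\<in>vecs H. \<forall>v\<in>vecs H. inner H v u = cnj (inner H u v)) \<and>
    (\<forall>v\<in>vecs H. v \<noteq> 0 \<longrightarrow> Re (inner H v v) > 0)"

definition linear_operator :: "('h::ab_group_add) hspace \<Rightarrow> ('h \<Rightarrow> 'h) \<Rightarrow> bool" where
  "linear_operator H f \<longleftrightarrow>
    (\<forall>v\<in>vecs H. f v \<in> vecs H) \<and>
    (\<forall>v\<in>vecs H. \<forall>w\<in>vecs H. f (v + w) = f v + f w) \<and>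
    (\<forall>v\<in>vecs H. \<forall>c. f (scale H c v) = scale H c (f v))"

definition is_adjoint :: "('h::ab_group_add) hspace \<Rightarrow> ('h \<Rightarrow> 'h) \<Rightarrow> ('h \<Rightarrow> 'h) \<Rightarrow> bool" where
  "is_adjoint H f g \<longleftrightarrow> (\<forall>v\<in>vecs H. \<forall>w\<in>vecs H. inner H (f v) w = inner H v (g w))"

text \<open>Multiplicity is algebraic: the dimension of the generalized eigenspace.\<close>

definition no_multiple_eigenvalues :: "('h::ab_group_add) hspace \<Rightarrow> ('h \<Rightarrow> 'h) \<Rightarrow> bool" where
  "no_multiple_eigenvalues H f \<longleftrightarrow>
    (\<forall>c. vector_space.dim (scale H)
      {v \<in> vecs H. \<exists>j. ((\<lambda>x. f x - scale H c x) ^^ j) v = 0} \<le> 1)"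

definition orthonormal_basis :: "('h::ab_group_add) hspace \<Rightarrow> nat \<Rightarrow> (nat \<Rightarrow> 'h) \<Rightarrow> bool" where
  "orthonormal_basis H n e \<longleftrightarrow>
    (\<forall>m<n. e m \<in> vecs H) \<and>
    (\<forall>l<n. \<forall>m<n. inner H (e l) (e m) = (if l = m then 1 else 0)) \<and>
    module.span (scale H) (e ` {..<n}) = vecs H"

text \<open>Hilbert spaces of every dimension exist over one fixed ambient type, so that quantifying over
  all of them is not vacuous.\<close>

lemma hilbert_space_dim_exists: "\<exists>H :: complex poly hspace. hilbert_space_dim H n"
proof -
  define S where "S = {p :: complex poly. \<forall>i\<ge>n. coeff p i = 0}"
  define ip where "ip = (\<lambda>p q :: complex poly. \<Sum>i<n. cnj (coeff p i) * coeff q i)"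
  define B where "B = (\<lambda>i. monom 1 i :: complex poly) ` {..<n}"
  interpret vs: vector_space "smult :: complex \<Rightarrow> complex poly \<Rightarrow> complex poly"
    by standard (simp_all add: smult_add_right smult_add_left)
  have sub: "vs.subspace S"
    by (auto simp: vs.subspace_def S_def)
  have fin: "finite B" by (simp add: B_def)
  have span: "vs.span B = S"
  proof (rule antisym)
    show "vs.span B \<subseteq> S"
      by (rule vs.span_minimal[OF _ sub]) (auto simp: B_def S_def)
    show "S \<subseteq> vs.span B"
    proof
      fix p assume "p \<in> S"
      then have "p = (\<Sum>i<n. smult (coeff p i) (monom 1 i))"
        by (intro poly_eqI) (auto simp: S_def coeff_sum if_distrib not_less
            sum.delta cong: if_cong)
      also have "\<dots> \<in> vs.span B"
        by (intro vs.span_sum vs.span_scale vs.span_base) (simp add: B_def)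
      finally show "p \<in> vs.span B" .
    qed
  qed
  have inj: "inj_on (\<lambda>i. monom (1::complex) i) {..<n}"
    by (auto simp: inj_on_def monom_eq_iff')
  have indep: "vs.independent B"
  proof (rule vs.independent_if_scalars_zero[OF fin])
    fix f x assume 0: "(\<Sum>x\<in>B. smult (f x) x) = 0" and "x \<in> B"
    then obtain j where j: "j < n" "x = monom 1 j" by (auto simp: B_def)
    have "coeff (\<Sum>i<n. smult (f (monom 1 i)) (monom 1 i)) j = 0"
      using 0 by (simp add: B_def sum.reindex[OF inj])
    then show "f x = 0"
      using j by (simp add: coeff_sum if_distrib cong: if_cong)
  qed
  have dim: "vs.dim S = n"
    using vs.dim_span_eq_card_independent[OF indep] card_image[OF inj] unfolding span
    by (simp add: B_def)
  have pos: "Re (ip p p) > 0" if p: "p \<in> S" "p \<noteq> 0" for p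
  proof -
    obtain j where j: "coeff p j \<noteq> 0" using p(2) by (meson leading_coeff_neq_0)
    then have "j < n" using p(1) by (auto simp: S_def not_less[symmetric])
    have "Re (ip p p) = (\<Sum>i<n. (cmod (coeff p i))\<^sup>2)"
      unfolding cmod_power2 by (simp add: ip_def power2_eq_square)
    also have "\<dots> > 0"
      using j \<open>j < n\<close> by (intro sum_pos2[of _ j]) auto
    finally show ?thesis .
  qed
  have "hilbert_space_dim \<lparr>vecs = S, scale = smult, inner = ip\<rparr> n"
    unfolding hilbert_space_dim_def
    using vs.vector_space_axioms sub fin span dim pos
    by (auto simp: ip_def distrib_left sum.distrib sum_distrib_left mult_ac)
  then show ?thesis by blast
qed

section \<open>Representations\<close>

definition representation ::
    "real \<Rightarrow> ('h::ab_group_add) hspace \<Rightarrow> (free_alg set \<Rightarrow> 'h \<Rightarrow> 'h) \<Rightarrow> bool" where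
  "representation R H \<Psi> \<longleftrightarrow>
    (\<forall>F\<in>carrier (alg R). linear_operator H (\<Psi> F)) \<and>
    (\<forall>v\<in>vecs H. \<Psi> \<one>\<^bsub>alg R\<^esub> v = v) \<and>
    (\<forall>F\<in>carrier (alg R). \<forall>G\<in>carrier (alg R). \<forall>v\<in>vecs H.
      \<Psi> (F \<oplus>\<^bsub>alg R\<^esub> G) v = \<Psi> F v + \<Psi> G v \<and>
      \<Psi> (F \<otimes>\<^bsub>alg R\<^esub> G) v = \<Psi> F (\<Psi> G v)) \<and>
    (\<forall>F\<in>carrier (alg R). \<forall>c. \<forall>v\<in>vecs H. \<Psi> (alg_scale R c F) v = scale H c (\<Psi> F v))"

definition irreducible_rep ::
    "real \<Rightarrow> ('h::ab_group_add) hspace \<Rightarrow> (free_alg set \<Rightarrow> 'h \<Rightarrow> 'h) \<Rightarrow> bool" where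
  "irreducible_rep R H \<Psi> \<longleftrightarrow>
    representation R H \<Psi> \<and> vecs H \<noteq> {0} \<and>
    (\<forall>W. module.subspace (scale H) W \<and> W \<subseteq> vecs H \<and>
         (\<forall>F\<in>carrier (alg R). \<forall>v\<in>W. \<Psi> F v \<in> W) \<longrightarrow> W = {0} \<or> W = vecs H)"

definition admissible_rep ::
    "real \<Rightarrow> nat \<Rightarrow> real \<Rightarrow> ('h::ab_group_add) hspace \<Rightarrow> (free_alg set \<Rightarrow> 'h \<Rightarrow> 'h) \<Rightarrow> bool" where
  "admissible_rep R n \<epsilon> H \<Psi> \<longleftrightarrow>
    hilbert_space_dim H n \<and>
    irreducible_rep R H \<Psi> \<and>
    (\<forall>F\<in>carrier (alg R). is_adjoint H (\<Psi> F) (\<Psi> (dagger F))) \<and>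
    \<epsilon> > 0 \<and> (\<forall>v\<in>vecs H. \<Psi> (eps R) v = scale H (of_real \<epsilon>) v) \<and>
    no_multiple_eigenvalues H (\<Psi> (u_elt R))"

text \<open>\<open>e m\<close> and \<open>C m\<close> are the basis vector and the constant labelled by \<open>\<beta> + m\<alpha>\<close>.\<close>

definition T2_rep ::
    "real \<Rightarrow> nat \<Rightarrow> nat \<Rightarrow> real \<Rightarrow> complex \<Rightarrow> ('h::ab_group_add) hspace \<Rightarrow>
      (free_alg set \<Rightarrow> 'h \<Rightarrow> 'h) \<Rightarrow> bool" where
  "T2_rep R n k \<beta> \<nu> H \<Psi> \<longleftrightarrow>
    1 \<le> k \<and> real k < real n / 2 \<and> coprime n k \<and> cmod \<nu> = 1 \<and>
    (\<exists>\<epsilon> \<alpha>. admissible_rep R n \<epsilon> H \<Psi> \<and>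
      0 < \<alpha> \<and> \<alpha> < pi \<and> tan (\<alpha> / 2) = \<epsilon> \<and> \<alpha> = 2 * pi * real k / real n \<and>
      (\<exists>e C. orthonormal_basis H n e \<and>
        (\<forall>m<n. C m \<noteq> 0 \<and>
          (cmod (C m))\<^sup>2 = inverse (cos (\<alpha> / 2)) * cos (\<beta> - \<alpha> / 2 + real m * \<alpha>) + R) \<and>
        (\<forall>m<n. \<Psi> (u_elt R) (e m) = scale H (exp (\<i> * of_real (\<beta> + real m * \<alpha>))) (e m)) \<and>
        (\<forall>m. 1 \<le> m \<and> m \<le> n - 1 \<longrightarrow>
          \<Psi> (a_minus R) (e m) = scale H (C m) (e (m - 1))) \<and>
        (\<forall>m. m + 2 \<le> n \<longrightarrow>
          \<Psi> (a_plus R) (e m) = scale H (cnj (C (m + 1))) (e (m + 1))) \<and>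
        \<Psi> (a_minus R) (e 0) = scale H (C 0) (e (n - 1)) \<and>
        \<Psi> (a_plus R) (e (n - 1)) = scale H (cnj (C 0)) (e 0) \<and>
        \<nu> = (\<Prod>m<n. C m) / of_real (cmod (\<Prod>m<n. C m))))"

end

theory Submission
  imports Defs
begin

text \<open>On the orthonormal basis the relations only constrain \<open>|C|\<^sup>2\<close>, so a representation with phase
  \<open>\<beta>\<close> exists precisely when all the prescribed values
  \<open>sec (\<alpha>/2) cos (\<beta>' + m\<alpha>) + R\<close> are positive: the shift operators with these
  weights then satisfy the relations by the sum-to-product formulas. As \<open>k\<close> is
  prime to \<open>n\<close>, the angles \<open>\<beta>' + m\<alpha>\<close> run modulo \<open>2\<pi>\<close> through
  all \<open>\<beta>' + 2\<pi>t/n\<close>, and positivity says that none of these lies within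
  \<open>arccos (R cos (\<alpha>/2))\<close> of \<open>\<pi>\<close>; one of them always lies within \<open>\<pi>/n\<close>.\<close>

section \<open>Modules over the presented algebra\<close>

text \<open>The weights come from solving two relations. Where u acts by exp(i \<theta>_m), w is cos
  \<theta>_m and z is sin \<theta>_m, while a_- and a_+ shift the index. Then x^2 + y^2 = w + R and
  [x,y] = i eps z become |C_m|^2 + |C_(m+1)|^2 = 2 (cos \<theta>_m + R) and |C_m|^2 - |C_(m+1)|^2 =
  2 tan(\<alpha>/2) sin \<theta>_m. Half their sum is R + cos \<theta>_m + tan(\<alpha>/2) sin
  \<theta>_m = R + sec(\<alpha>/2) cos(\<theta>_m - \<alpha>/2). Necessity costs nothing, because a
  \<open>T2_rep\<close> already contains nonzero constants with these squared moduli; the work is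
  the construction. Its obstacle is that the algebra is a quotient of a free algebra and the given
  space a subspace of an ambient one: operators obtained by linear extension are controlled on
  \<open>vecs H\<close> only, so the relations are proved there and nowhere else.\<close>

lemma cls_ring_hom: "cls R \<in> ring_hom free_ring (alg R)"
  using ideal.rcos_ring_hom[OF ideal_rel_ideal, of R] by (simp add: cls_def[abs_def] alg_def)

lemma cls_one: "\<one>\<^bsub>alg R\<^esub> = cls R 1"
  using ring_hom_one[OF cls_ring_hom, of R] by (simp add: free_ring_def)

lemma cls_add: "cls R f \<oplus>\<^bsub>alg R\<^esub> cls R g = cls R (f + g)"
  using ring_hom_add[OF cls_ring_hom, of f g R] by (simp add: free_ring_def)

lemma cls_mult: "cls R f \<otimes>\<^bsub>alg R\<^esub> cls R g = cls R (f * g)"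
  using ring_hom_mult[OF cls_ring_hom, of f g R] by (simp add: free_ring_def)

text \<open>The operators live on the whole ambient space, which makes linearity unconditional; an
  invariant subspace enters only where it is needed.\<close>

locale generator_action = vector_space sc
  for sc :: "complex \<Rightarrow> 'h::ab_group_add \<Rightarrow> 'h" +
  fixes T :: "generator \<Rightarrow> 'h \<Rightarrow> 'h"
  assumes linear_T: "Vector_Spaces.linear sc sc (T g)"
begin

text \<open>Evaluation of a noncommutative polynomial at the operators. \<open>foldr\<close> applies
  the last letter first, so concatenation of words becomes composition and the free algebra acts
  from the left.\<close>

definition act :: "free_alg \<Rightarrow> 'h \<Rightarrow> 'h" where
  "act f v = (\<Sum>w\<in>Poly_Mapping.keys f. sc (Poly_Mapping.lookup f w) (foldr T (letters w) v))"

sublocale T: Vector_Spaces.linear sc sc "T g" for g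
  by (rule linear_T)

sublocale Tw: Vector_Spaces.linear sc sc "foldr T ws" for ws
proof (induction ws)
  case Nil
  show ?case by (simp add: Vector_Spaces.linear_iff vector_space_axioms)
next
  case (Cons g ws)
  show ?case
    using Vector_Spaces.linear_compose[OF Cons linear_T[of g]] by (simp add: comp_def)
qed

sublocale act: Vector_Spaces.linear sc sc "act f" for f
  by unfold_locales
    (simp_all add: act_def Tw.add Tw.scale scale_right_distrib sum.distrib scale_sum_right mult.commute)

lemma act_0 [simp]: "act 0 v = 0"
  by (simp add: act_def)

lemma act_add: "act (f + g) v = act f v + act g v"
  unfolding act_def
  by (rule setsum_keys_plus_distrib) (simp_all add: scale_left_distrib)

lemma act_minus: "act (f - g) v = act f v - act g v"
  using act_add[of "f - g" g v] by simp

lemma act_single: "act (Poly_Mapping.single w c) v = sc c (foldr T (letters w) v)"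
  by (simp add: act_def)

lemma act_mult: "act (f * g) v = act f (act g v)"
proof (induction f rule: free_alg_induct)
  case zero
  then show ?case by simp
next
  case (add f w c)
  have "act (Poly_Mapping.single w c * g) v = act (Poly_Mapping.single w c) (act g v)"
  proof (induction g rule: free_alg_induct)
    case zero
    then show ?case by (simp add: act.zero)
  next
    case (add g w' c')
    then show ?case
      by (simp add: distrib_left act_add act.add mult_single act_single plus_word_def Tw.scale)
  qed
  with add show ?case by (simp add: distrib_right act_add)
qed

lemma act_const [simp]: "act (const c) v = sc c v"
  by (simp add: const_def act_single zero_word_def)

lemma act_one [simp]: "act 1 v = v"
  using act_const[of 1 v] by (simp add: const_def)

lemma act_gen [simp]: "act (gen g) v = T g v"
  by (simp add: gen_def act_single)

lemma foldr_T_mem: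
  assumes "\<And>g v. v \<in> V \<Longrightarrow> T g v \<in> V" "v \<in> V"
  shows "foldr T ws v \<in> V"
  by (induction ws) (auto simp: assms)

lemma act_mem:
  assumes "subspace V" "\<And>g v. v \<in> V \<Longrightarrow> T g v \<in> V" "v \<in> V"
  shows "act f v \<in> V"
  unfolding act_def
  by (intro subspace_sum subspace_scale foldr_T_mem assms)

text \<open>Closure under right multiplication is the point that needs V invariant:
  \<open>act (r * f) v = act r (act f v)\<close> vanishes because \<open>act f v\<close> is again in
  V.\<close>

lemma annihilator_ideal:
  assumes V: "subspace V" "\<And>g v. v \<in> V \<Longrightarrow> T g v \<in> V"
  shows "ideal {f. \<forall>v\<in>V. act f v = 0} free_ring"
proof (rule idealI[OF ring_free_ring])
  show "subgroup {f. \<forall>v\<in>V. act f v = 0} (add_monoid free_ring)"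
  proof (rule group.subgroupI)
    show "Group.group (add_monoid free_ring)"
      using ring.is_abelian_group[OF ring_free_ring] abelian_group.a_group by blast
    fix a assume a: "a \<in> {f. \<forall>v\<in>V. act f v = 0}"
    have "inv\<^bsub>add_monoid free_ring\<^esub> a = - a"
      using abelian_group.minus_equality[OF ring.is_abelian_group[OF ring_free_ring], of "- a" a]
      by (simp add: free_ring_def a_inv_def)
    then show "inv\<^bsub>add_monoid free_ring\<^esub> a \<in> {f. \<forall>v\<in>V. act f v = 0}"
      using a act_minus[of 0 a] by simp
  qed (auto simp: free_ring_def act_add intro!: exI[of _ 0])
qed (auto simp: free_ring_def act_mult act.zero act_mem[OF V])

end

text \<open>The relators are required to vanish on \<open>vecs H\<close> alone, since the linear
  extensions used later satisfy no relation elsewhere.\<close>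

locale algebra_action =
  fixes R :: real and H :: "('h::ab_group_add) hspace" and T :: "generator \<Rightarrow> 'h \<Rightarrow> 'h"
  assumes gen_action: "generator_action (scale H) T"
    and subspace_vecs: "module.subspace (scale H) (vecs H)"
    and T_mem: "v \<in> vecs H \<Longrightarrow> T g v \<in> vecs H"
    and relators_act: "r \<in> relators R \<Longrightarrow> v \<in> vecs H \<Longrightarrow> generator_action.act (scale H) T r v = 0"
begin

sublocale generator_action "scale H" T
  by (rule gen_action)

text \<open>A coset acts through an arbitrary representative; \<open>induced_cls\<close> shows that
  the choice is immaterial on \<open>vecs H\<close>.\<close>

definition induced :: "free_alg set \<Rightarrow> 'h \<Rightarrow> 'h" where
  "induced F = act (SOME f. f \<in> F)"

lemma rel_ideal_act:
  assumes "r \<in> rel_ideal R" "v \<in> vecs H"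
  shows "act r v = 0"
proof -
  have "rel_ideal R \<subseteq> {f. \<forall>v\<in>vecs H. act f v = 0}"
    unfolding rel_ideal_def
    by (rule ring.genideal_minimal[OF ring_free_ring])
      (auto intro!: annihilator_ideal subspace_vecs T_mem simp: relators_act)
  then show ?thesis using assms by auto
qed

lemma induced_cls:
  assumes "v \<in> vecs H"
  shows "induced (cls R f) v = act f v"
proof -
  have "f \<in> cls R f"
    using rel_ideal_closed(4)[of R] by (force simp: cls_eq)
  then have "(SOME g. g \<in> cls R f) \<in> cls R f"
    by (rule someI)
  then obtain r where "r \<in> rel_ideal R" "(SOME g. g \<in> cls R f) = r + f"
    by (auto simp: cls_eq)
  then show ?thesis
    using rel_ideal_act[OF _ assms] by (simp add: induced_def act_add)
qed

lemma act_vecs: "v \<in> vecs H \<Longrightarrow> act f v \<in> vecs H"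
  by (rule act_mem[OF subspace_vecs T_mem])

lemma representation_induced: "Defs.representation R H induced"
proof -
  have "linear_operator H (induced (cls R f))" for f
    using subspace_vecs
    by (auto simp: linear_operator_def induced_cls act_vecs subspace_add subspace_scale act.add act.scale)
  then show ?thesis
    by (auto simp: Defs.representation_def carrier_alg cls_one cls_add cls_mult alg_scale_def
        induced_cls act_add act_mult act_vecs)
qed

text \<open>Self-adjoint generators suffice: passing a word across the inner product reverses it and
  conjugates its coefficient, which is what \<open>star\<close> does. The laws of the inner product
  are hypotheses because this locale assumes nothing about \<open>inner\<close>.\<close>

lemma is_adjoint_induced:
  assumes add: "\<And>u v w. u \<in> vecs H \<Longrightarrow> v \<in> vecs H \<Longrightarrow> w \<in> vecs H \<Longrightarrow>
      inner H u (v + w) = inner H u v + inner H u w"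
    and scl: "\<And>u v c. u \<in> vecs H \<Longrightarrow> v \<in> vecs H \<Longrightarrow> inner H u (scale H c v) = c * inner H u v"
    and sym: "\<And>u v. u \<in> vecs H \<Longrightarrow> v \<in> vecs H \<Longrightarrow> inner H v u = cnj (inner H u v)"
    and self: "\<And>g. is_adjoint H (T g) (T g)"
    and F: "F \<in> carrier (alg R)"
  shows "is_adjoint H (induced F) (induced (dagger F))"
proof -
  note mem = subspace_scale[OF subspace_vecs] subspace_add[OF subspace_vecs]
    subspace_0[OF subspace_vecs] foldr_T_mem[OF T_mem] act_vecs
  have addl: "inner H (u + v) w = inner H u w + inner H v w"
    if "u \<in> vecs H" "v \<in> vecs H" "w \<in> vecs H" for u v w
    using sym[of w "u + v"] sym[of w u] sym[of w v] add[of w u v] that by (simp add: mem)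
  have scll: "inner H (scale H c u) v = cnj c * inner H u v"
    if "u \<in> vecs H" "v \<in> vecs H" for u v c
    using sym[of v "scale H c u"] sym[of v u] scl[of v u c] that by (simp add: mem)
  have word: "inner H (foldr T ws v) w = inner H v (foldr T (rev ws) w)"
    if "v \<in> vecs H" "w \<in> vecs H" for ws v w
    using that
  proof (induction ws arbitrary: w)
    case (Cons g ws)
    then show ?case using self[of g] by (simp add: is_adjoint_def mem T_mem)
  qed simp
  have "inner H (act f v) w = inner H v (act (star f) w)"
    if v: "v \<in> vecs H" and w: "w \<in> vecs H" for f v w
  proof (induction f rule: free_alg_induct)
    case zero
    then show ?case
      using scl[of v 0 0] scll[of 0 w 0] v w by (simp add: mem)
  next
    case (add f u c)
    have "inner H (act (f + Poly_Mapping.single u c) v) w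
        = inner H (act f v) w + cnj c * inner H (foldr T (letters u) v) w"
      using v w by (simp add: act_add act_single addl scll mem)
    also have "\<dots> = inner H v (act (star f) w) + cnj c * inner H v (foldr T (rev (letters u)) w)"
      by (simp add: add word v w)
    also have "\<dots> = inner H v (act (star (f + Poly_Mapping.single u c)) w)"
      using v w assms(1) by (simp add: star_add star_single act_add act_single rev_word_def scl mem)
    finally show ?case .
  qed
  moreover obtain f where "F = cls R f"
    using F by (auto simp: carrier_alg)
  ultimately show ?thesis
    by (simp add: is_adjoint_def dagger_cls induced_cls)
qed

end

section \<open>Orthonormal bases\<close>

locale finite_hilbert =
  fixes H :: "('h::ab_group_add) hspace" and n :: nat
  assumes hilbert: "hilbert_space_dim H n"
begin

sublocale vector_space "scale H"
  using hilbert unfolding hilbert_space_dim_def by blast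

lemma dim_vecs: "dim (vecs H) = n"
  using hilbert unfolding hilbert_space_dim_def by blast

lemma subspace_vecs: "subspace (vecs H)"
  using hilbert unfolding hilbert_space_dim_def by blast

lemmas vecs_closed [simp] =
  subspace_add[OF subspace_vecs] subspace_diff[OF subspace_vecs] subspace_scale[OF subspace_vecs]
  subspace_0[OF subspace_vecs]

lemma sum_vecs [simp]:
  fixes j :: nat
  shows "(\<And>i. i < j \<Longrightarrow> f i \<in> vecs H) \<Longrightarrow> (\<Sum>i<j. f i) \<in> vecs H"
  by (intro subspace_sum[OF subspace_vecs]) simp

lemma inner_add_right:
  "u \<in> vecs H \<Longrightarrow> v \<in> vecs H \<Longrightarrow> w \<in> vecs H \<Longrightarrow> inner H u (v + w) = inner H u v + inner H u w"
  using hilbert unfolding hilbert_space_dim_def by blast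

lemma inner_scale_right:
  "u \<in> vecs H \<Longrightarrow> v \<in> vecs H \<Longrightarrow> inner H u (scale H c v) = c * inner H u v"
  using hilbert unfolding hilbert_space_dim_def by blast

lemma inner_commute: "u \<in> vecs H \<Longrightarrow> v \<in> vecs H \<Longrightarrow> inner H v u = cnj (inner H u v)"
  using hilbert unfolding hilbert_space_dim_def by blast

lemma inner_pos: "v \<in> vecs H \<Longrightarrow> v \<noteq> 0 \<Longrightarrow> Re (inner H v v) > 0"
  using hilbert unfolding hilbert_space_dim_def by blast

lemma inner_zero_right [simp]: "u \<in> vecs H \<Longrightarrow> inner H u 0 = 0"
  using inner_add_right[of u 0 0] by simp

lemma inner_diff_right:
  "u \<in> vecs H \<Longrightarrow> v \<in> vecs H \<Longrightarrow> w \<in> vecs H \<Longrightarrow> inner H u (v - w) = inner H u v - inner H u w"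
  using inner_add_right[of u "v - w" w] by simp

lemma inner_sum_right:
  fixes j :: nat
  assumes "u \<in> vecs H" "\<And>i. i < j \<Longrightarrow> f i \<in> vecs H"
  shows "inner H u (\<Sum>i<j. f i) = (\<Sum>i<j. inner H u (f i))"
  using assms by (induction j) (simp_all add: inner_add_right)

lemma inner_add_left:
  assumes "u \<in> vecs H" "v \<in> vecs H" "w \<in> vecs H"
  shows "inner H (u + v) w = inner H u w + inner H v w"
  using inner_commute[of w "u + v"] inner_commute[of w u] inner_commute[of w v]
    inner_add_right[of w u v] assms by simp

lemma inner_scale_left:
  assumes "u \<in> vecs H" "v \<in> vecs H"
  shows "inner H (scale H c u) v = cnj c * inner H u v"
  using inner_commute[of v "scale H c u"] inner_commute[of v u] inner_scale_right[of v u c] assms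
  by simp

lemma inner_diff_left:
  assumes "u \<in> vecs H" "v \<in> vecs H" "w \<in> vecs H"
  shows "inner H (u - v) w = inner H u w - inner H v w"
  using inner_add_left[of "u - v" v w] assms by simp

lemma inner_self_of_real: "v \<in> vecs H \<Longrightarrow> inner H v v = of_real (Re (inner H v v))"
  by (metis Reals_cnj_iff inner_commute of_real_Re)

section \<open>Independence, extension and spanning for orthonormal families\<close>

lemma inner_orthonormal_sum:
  fixes j :: nat and e :: "nat \<Rightarrow> 'h"
  assumes "\<And>i. i < j \<Longrightarrow> e i \<in> vecs H"
    and "\<And>i k. i < j \<Longrightarrow> k < j \<Longrightarrow> inner H (e i) (e k) = (if i = k then 1 else 0)"
    and "i < j"
  shows "inner H (e i) (\<Sum>k<j. scale H (c k) (e k)) = c i"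
proof -
  have "inner H (e i) (\<Sum>k<j. scale H (c k) (e k)) = (\<Sum>k<j. c k * inner H (e i) (e k))"
    using assms(1,3) by (simp add: inner_sum_right inner_scale_right)
  also have "\<dots> = (\<Sum>k<j. if i = k then c k else 0)"
    using assms(3) by (intro sum.cong) (auto simp: assms(2))
  finally show ?thesis using assms(3) by simp
qed

lemma orthonormal_independent:
  fixes j :: nat
  assumes mem: "\<And>i. i < j \<Longrightarrow> e i \<in> vecs H"
    and on: "\<And>i k. i < j \<Longrightarrow> k < j \<Longrightarrow> inner H (e i) (e k) = (if i = k then 1 else 0)"
  shows "inj_on e {..<j}" and "independent (e ` {..<j})"
proof -
  show inj: "inj_on e {..<j}"
    using on by (intro inj_onI) (metis lessThan_iff zero_neq_one)
  show "independent (e ` {..<j})"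
  proof (rule independent_if_scalars_zero)
    fix f x assume z: "(\<Sum>x\<in>e ` {..<j}. scale H (f x) x) = 0" and "x \<in> e ` {..<j}"
    then obtain i where i: "i < j" "x = e i" by auto
    have "inner H (e i) (\<Sum>k<j. scale H (f (e k)) (e k)) = f (e i)"
      by (rule inner_orthonormal_sum) (use mem on i in auto)
    then show "f x = 0"
      using z i mem by (simp add: sum.reindex[OF inj])
  qed simp
qed

text \<open>One Gram-Schmidt step: fewer than n vectors cannot span \<open>vecs H\<close>, so some v
  lies outside their span; subtracting its projection \<open>s\<close> leaves a nonzero vector,
  which is then normalised.\<close>

lemma extend_orthonormal:
  fixes j :: nat
  assumes mem: "\<And>i. i < j \<Longrightarrow> e i \<in> vecs H"
    and on: "\<And>i k. i < j \<Longrightarrow> k < j \<Longrightarrow> inner H (e i) (e k) = (if i = k then 1 else 0)"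
    and j: "j < n"
  obtains x where "x \<in> vecs H" "inner H x x = 1"
    "\<And>i. i < j \<Longrightarrow> inner H (e i) x = 0" "\<And>i. i < j \<Longrightarrow> inner H x (e i) = 0"
proof -
  have "\<not> vecs H \<subseteq> span (e ` {..<j})"
  proof
    assume "vecs H \<subseteq> span (e ` {..<j})"
    then have "dim (vecs H) \<le> card (e ` {..<j})" by (rule dim_le_card) simp
    also have "\<dots> \<le> j" using card_image_le[of "{..<j}" e] by simp
    finally show False using j dim_vecs by simp
  qed
  then obtain v where v: "v \<in> vecs H" "v \<notin> span (e ` {..<j})" by blast
  define s where "s = (\<Sum>k<j. scale H (inner H (e k) v) (e k))"
  define y where "y = v - s"
  have s: "s \<in> vecs H" "s \<in> span (e ` {..<j})"
    using mem unfolding s_def by simp (auto intro!: span_sum span_scale intro: span_base)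
  have y: "y \<in> vecs H" "y \<noteq> 0"
    using v s by (auto simp: y_def)
  have orth: "inner H (e i) y = 0" if "i < j" for i
    using inner_orthonormal_sum[of j e i, OF mem on that] mem that v s
    by (simp add: y_def inner_diff_right s_def)
  define c where "c = complex_of_real (1 / sqrt (Re (inner H y y)))"
  define r where "r = Re (inner H y y)"
  have r: "r > 0" "inner H y y = of_real r"
    using inner_pos[OF y] inner_self_of_real[OF y(1)] by (simp_all add: r_def)
  have "inner H (scale H c y) (scale H c y) = cnj c * (c * of_real r)"
    using y r by (simp add: inner_scale_left inner_scale_right)
  also have "\<dots> = of_real ((1 / sqrt r)\<^sup>2 * r)"
    by (simp only: c_def r_def[symmetric] complex_cnj_complex_of_real of_real_mult power2_eq_square mult.assoc)
  also have "\<dots> = 1"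
    using r by (simp add: power_divide)
  finally have "inner H (scale H c y) (scale H c y) = 1" .
  moreover have "inner H (scale H c y) (e i) = 0" if "i < j" for i
    using orth[OF that] inner_commute[of "e i" y] mem[OF that] y by (simp add: inner_scale_left)
  moreover have "inner H (e i) (scale H c y) = 0" if "i < j" for i
    using orth[OF that] mem[OF that] y by (simp add: inner_scale_right)
  ultimately show ?thesis using that[of "scale H c y"] y by simp
qed

lemma orthonormal_family_exists:
  "j \<le> n \<Longrightarrow> \<exists>e. (\<forall>i<j. e i \<in> vecs H) \<and>
    (\<forall>i<j. \<forall>k<j. inner H (e i) (e k) = (if i = k then 1 else 0))"
proof (induction j)
  case (Suc j)
  then obtain e :: "nat \<Rightarrow> 'h" where e: "\<And>i. i < j \<Longrightarrow> e i \<in> vecs H"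
    "\<And>i k. i < j \<Longrightarrow> k < j \<Longrightarrow> inner H (e i) (e k) = (if i = k then 1 else 0)"
    by auto
  obtain x where "x \<in> vecs H" "inner H x x = 1"
    "\<And>i. i < j \<Longrightarrow> inner H (e i) x = 0" "\<And>i. i < j \<Longrightarrow> inner H x (e i) = 0"
    using extend_orthonormal[of j e, OF e] Suc.prems by auto
  with e show ?case
    by (intro exI[of _ "e(j := x)"]) (auto simp: less_Suc_eq)
qed simp

text \<open>A vector outside the span would give n + 1 independent vectors inside the span of a
  basis of n elements.\<close>

lemma orthonormal_spans:
  fixes e :: "nat \<Rightarrow> 'h"
  assumes mem: "\<And>i. i < n \<Longrightarrow> e i \<in> vecs H"
    and on: "\<And>i k. i < n \<Longrightarrow> k < n \<Longrightarrow> inner H (e i) (e k) = (if i = k then 1 else 0)"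
  shows "span (e ` {..<n}) = vecs H"
proof
  show "span (e ` {..<n}) \<subseteq> vecs H"
    using mem by (intro span_minimal subspace_vecs) auto
  obtain B0 where B0: "finite B0" "span B0 = vecs H"
    using hilbert unfolding hilbert_space_dim_def by blast
  obtain B where B: "B \<subseteq> vecs H" "independent B" "vecs H \<subseteq> span B" "card B = dim (vecs H)"
    using basis_exists by blast
  have "finite B" using independent_span_bound[OF B0(1) B(2)] B(1) B0(2) by simp
  have cB: "card B = n" using B(4) dim_vecs by simp
  note ind = orthonormal_independent[of n e, OF mem on, simplified]
  show "vecs H \<subseteq> span (e ` {..<n})"
  proof (rule ccontr)
    assume "\<not> vecs H \<subseteq> span (e ` {..<n})"
    then obtain v where v: "v \<in> vecs H" "v \<notin> span (e ` {..<n})" by blast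
    have "independent (insert v (e ` {..<n}))"
      using v(2) ind(2) by (rule independent_insertI)
    moreover have "insert v (e ` {..<n}) \<subseteq> span B"
      using v(1) mem B(3) by auto
    ultimately have "card (insert v (e ` {..<n})) \<le> n"
      using independent_span_bound[OF \<open>finite B\<close>, of "insert v (e ` {..<n})"] unfolding cB by simp
    moreover have "v \<notin> e ` {..<n}"
      using v(2) span_base[of v "e ` {..<n}"] by argo
    ultimately show False
      by (simp add: card_image[OF ind(1)])
  qed
qed

lemma orthonormal_basis_exists: "\<exists>e. orthonormal_basis H n e"
proof -
  obtain e where "\<forall>i<n. e i \<in> vecs H"
    "\<forall>i<n. \<forall>k<n. inner H (e i) (e k) = (if i = k then 1 else 0)"
    using orthonormal_family_exists[of n] by auto
  then show ?thesis
    using orthonormal_spans[of e] by (auto simp: orthonormal_basis_def)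
qed

end

section \<open>Operators determined by an orthonormal basis\<close>

locale based_hilbert = finite_hilbert +
  fixes e :: "nat \<Rightarrow> 'a"
  assumes onb: "orthonormal_basis H n e"
begin

lemma e_mem [simp]: "m < n \<Longrightarrow> e m \<in> vecs H"
  using onb by (simp add: orthonormal_basis_def)

lemma inner_e: "l < n \<Longrightarrow> m < n \<Longrightarrow> inner H (e l) (e m) = (if l = m then 1 else 0)"
  using onb by (simp add: orthonormal_basis_def)

lemma span_e: "span (e ` {..<n}) = vecs H"
  using onb by (simp add: orthonormal_basis_def)

lemma independent_e: "inj_on e {..<n}" "independent (e ` {..<n})"
  using orthonormal_independent[of n e] inner_e by auto

lemma expansion:
  assumes "v \<in> vecs H"
  shows "v = (\<Sum>m<n. scale H (inner H (e m) v) (e m))"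
proof -
  have "v \<in> span (e ` {..<n})" using assms by (simp add: span_e)
  then obtain c where "v = (\<Sum>x\<in>e ` {..<n}. scale H (c x) x)"
    by (auto simp: span_finite)
  then have v: "v = (\<Sum>m<n. scale H (c (e m)) (e m))"
    by (simp add: sum.reindex[OF independent_e(1)])
  have "inner H (e m) v = c (e m)" if "m < n" for m
    unfolding v using that by (intro inner_orthonormal_sum) (auto simp: inner_e)
  then show ?thesis using v by (metis (no_types, lifting) lessThan_iff sum.cong)
qed

lemma vec_eq_0I:
  assumes "v \<in> vecs H" "\<And>m. m < n \<Longrightarrow> inner H (e m) v = 0"
  shows "v = 0"
proof -
  have "(\<Sum>m<n. scale H (inner H (e m) v) (e m)) = 0"
    by (intro sum.neutral) (simp add: assms(2))
  then show ?thesis using expansion[OF assms(1)] by metis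
qed

lemma linear_with_images:
  obtains A where "Vector_Spaces.linear (scale H) (scale H) A" "\<And>m. m < n \<Longrightarrow> A (e m) = f m"
proof -
  interpret p: vector_space_pair "scale H" "scale H" by unfold_locales
  obtain A where A: "Vector_Spaces.linear (scale H) (scale H) A"
      "\<forall>x\<in>e ` {..<n}. A x = f (inv_into {..<n} e x)"
    using p.linear_independent_extend[OF independent_e(2), of "\<lambda>x. f (inv_into {..<n} e x)"] by blast
  then show ?thesis using that[of A] by (simp add: independent_e(1))
qed

lemma linear_eq_on_vecs:
  assumes "Vector_Spaces.linear (scale H) (scale H) A" "Vector_Spaces.linear (scale H) (scale H) B"
    and "\<And>m. m < n \<Longrightarrow> A (e m) = B (e m)" and "v \<in> vecs H"
  shows "A v = B v"
proof -
  interpret p: vector_space_pair "scale H" "scale H" by unfold_locales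
  show ?thesis
    by (rule p.linear_eq_on[OF assms(1,2), of v "e ` {..<n}"]) (use assms span_e in auto)
qed

lemma linear_vecs:
  assumes "Vector_Spaces.linear (scale H) (scale H) A"
    and "\<And>m. m < n \<Longrightarrow> A (e m) \<in> vecs H" and "v \<in> vecs H"
  shows "A v \<in> vecs H"
proof -
  interpret A: Vector_Spaces.linear "scale H" "scale H" A by fact
  have "A v = (\<Sum>m<n. scale H (inner H (e m) v) (A (e m)))"
    using arg_cong[OF expansion[OF assms(3)], of A] by (simp only: A.sum A.scale)
  then show ?thesis using assms(2) by simp
qed

lemma is_adjointI:
  assumes lin: "Vector_Spaces.linear (scale H) (scale H) A" "Vector_Spaces.linear (scale H) (scale H) B"
    and mem: "\<And>m. m < n \<Longrightarrow> A (e m) \<in> vecs H" "\<And>m. m < n \<Longrightarrow> B (e m) \<in> vecs H"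
    and eq: "\<And>l m. l < n \<Longrightarrow> m < n \<Longrightarrow> inner H (A (e l)) (e m) = inner H (e l) (B (e m))"
  shows "is_adjoint H A B"
  unfolding is_adjoint_def
proof (intro ballI)
  interpret A: Vector_Spaces.linear "scale H" "scale H" A by fact
  interpret B: Vector_Spaces.linear "scale H" "scale H" B by fact
  fix v w assume v: "v \<in> vecs H" and w: "w \<in> vecs H"
  \<comment> \<open>The inner product is conjugate-linear in its first argument, so the expansion of
    v contributes conjugated coefficients.\<close>
  have suml: "inner H (\<Sum>i<n. scale H (c i) (f i)) x = (\<Sum>i<n. cnj (c i) * inner H (f i) x)"
    if f: "\<And>i. i < n \<Longrightarrow> f i \<in> vecs H" and x: "x \<in> vecs H" for c :: "nat \<Rightarrow> complex" and f x
  proof -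
    have "inner H (\<Sum>i<n. scale H (c i) (f i)) x = cnj (inner H x (\<Sum>i<n. scale H (c i) (f i)))"
      by (rule inner_commute) (use f x in auto)
    also have "\<dots> = (\<Sum>i<n. cnj (c i) * cnj (inner H x (f i)))"
      using f x by (simp add: inner_sum_right inner_scale_right)
    also have "\<dots> = (\<Sum>i<n. cnj (c i) * inner H (f i) x)"
    proof (rule sum.cong)
      fix i assume "i \<in> {..<n}"
      then show "cnj (c i) * cnj (inner H x (f i)) = cnj (c i) * inner H (f i) x"
        using inner_commute[of x "f i"] f x by simp
    qed simp
    finally show ?thesis .
  qed
  define a b where "a = (\<lambda>i. inner H (e i) v)" and "b = (\<lambda>i. inner H (e i) w)"
  have v': "v = (\<Sum>i<n. scale H (a i) (e i))" and w': "w = (\<Sum>i<n. scale H (b i) (e i))"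
    unfolding a_def b_def by (rule expansion[OF v], rule expansion[OF w])
  have Av: "A v = (\<Sum>i<n. scale H (a i) (A (e i)))"
    using arg_cong[OF v', of A] by (simp only: A.sum A.scale)
  have Bw: "B w = (\<Sum>i<n. scale H (b i) (B (e i)))"
    using arg_cong[OF w', of B] by (simp only: B.sum B.scale)
  have "inner H (A v) w = (\<Sum>i<n. cnj (a i) * inner H (A (e i)) w)"
    unfolding Av using mem w by (intro suml) auto
  also have "\<dots> = (\<Sum>i<n. cnj (a i) * inner H (e i) (B w))"
  proof (rule sum.cong)
    fix i assume i: "i \<in> {..<n}"
    have "inner H (A (e i)) (\<Sum>k<n. scale H (b k) (e k)) = (\<Sum>k<n. b k * inner H (A (e i)) (e k))"
      using i mem by (simp add: inner_sum_right inner_scale_right)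
    then have "inner H (A (e i)) w = (\<Sum>k<n. b k * inner H (A (e i)) (e k))"
      by (simp only: w'[symmetric])
    also have "\<dots> = inner H (e i) (B w)"
      using i mem eq by (simp add: Bw inner_sum_right inner_scale_right)
    finally show "cnj (a i) * inner H (A (e i)) w = cnj (a i) * inner H (e i) (B w)" by simp
  qed simp
  also have "\<dots> = inner H v (B w)"
  proof -
    have "B w \<in> vecs H" using mem by (simp add: Bw)
    then show ?thesis using suml[of e "B w" a] by (simp add: v'[symmetric])
  qed
  finally show "inner H (A v) w = inner H v (B w)" .
qed

end

section \<open>The cyclic shift representation\<close>

lemma periodic_mod:
  fixes f :: "nat \<Rightarrow> 'b"
  assumes "\<And>m. f (m + n) = f m"
  shows "f (m mod n) = f m"
proof -
  have "f (a + b * n) = f a" for a b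
    by (induction b) (use assms[of "a + c * n" for c] in \<open>simp_all add: add_ac\<close>)
  from this[of "m mod n" "m div n"] show ?thesis by simp
qed

text \<open>Lowering and raising are inverse permutations of the indices modulo n. The predecessor
  is written \<open>l + n - 1\<close> because \<open>l - 1\<close> would truncate at 0.\<close>

lemma pred_mod_eq_iff:
  assumes "l < n" "m < (n::nat)"
  shows "(l + n - 1) mod n = m \<longleftrightarrow> l = Suc m mod n"
proof -
  have "(l + n - 1) mod n = (if l = 0 then n - 1 else l - 1)"
  proof (cases "l = 0")
    case False
    then have "l + n - 1 = (l - 1) + n" by simp
    with False assms show ?thesis by (metis mod_add_self2 mod_less less_imp_diff_less)
  qed (use assms in simp)
  then show ?thesis using assms by (auto simp: mod_Suc split: if_splits)
qed

text \<open>\<open>C\<close> is indexed by all naturals with period n, so the entry that closes the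
  cycle obeys the same formula as the others. This is consistent because n steps of \<alpha> make k
  full turns.\<close>

locale shift_model = based_hilbert H n e
  for H :: "('h::ab_group_add) hspace" and n :: nat and e :: "nat \<Rightarrow> 'h" +
  fixes R \<alpha> \<beta> :: real and k :: nat and C :: "nat \<Rightarrow> complex"
  assumes n_pos: "0 < n"
    and coprime_nk: "coprime n k"
    and n_alpha: "real n * \<alpha> = 2 * pi * real k"
    and alpha: "0 < \<alpha>" "\<alpha> < pi"
    and C_period: "C (m + n) = C m"
    and C_nonzero: "C m \<noteq> 0"
    and C_norm: "(cmod (C m))\<^sup>2 = inverse (cos (\<alpha> / 2)) * cos (\<beta> - \<alpha> / 2 + real m * \<alpha>) + R"
begin

definition \<theta> :: "nat \<Rightarrow> real" where "\<theta> m = \<beta> + real m * \<alpha>"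

text \<open>The basis continued periodically, which removes the case distinction at the ends of the
  cycle from all later computations.\<close>

definition E :: "nat \<Rightarrow> 'h" where "E m = e (m mod n)"

lemma E_mem [simp]: "E m \<in> vecs H"
  by (simp add: E_def n_pos)

lemma E_less: "m < n \<Longrightarrow> E m = e m"
  by (simp add: E_def)

lemma E_period: "E (m + n) = E m"
  by (simp add: E_def)

lemma C_mod: "C (m mod n) = C m"
  by (rule periodic_mod) (rule C_period)

lemma \<theta>_add_n: "\<theta> (m + n) = \<theta> m + 2 * pi * real k"
  using n_alpha by (simp add: \<theta>_def distrib_right)

lemma cos_\<theta>_mod: "cos (\<theta> (m mod n)) = cos (\<theta> m)"
  using cos_2npi[of k] sin_2npi[of k] by (intro periodic_mod) (simp add: \<theta>_add_n cos_add mult_ac)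

lemma sin_\<theta>_mod: "sin (\<theta> (m mod n)) = sin (\<theta> m)"
  using cos_2npi[of k] sin_2npi[of k] by (intro periodic_mod) (simp add: \<theta>_add_n sin_add mult_ac)

lemma cos_half_pos: "cos (\<alpha> / 2) > 0"
  using alpha by (intro cos_gt_zero) auto

text \<open>Both differences and sums factor through the cosine of the mean angle, and the remaining
  ratio is tan(\<alpha>/2). This is why eps has to be tan(\<alpha>/2), and it is the whole content
  of the commutators [y,z] and [z,x].\<close>

lemma sin_step: "sin (\<theta> (Suc m)) - sin (\<theta> m) = tan (\<alpha> / 2) * (cos (\<theta> (Suc m)) + cos (\<theta> m))"
  using cos_half_pos
  by (simp add: sin_diff_sin cos_plus_cos \<theta>_def tan_def algebra_simps)

text \<open>\<open>Am\<close>, \<open>Ap\<close> and \<open>Z\<close> are to become a_-, a_+ and z.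
  Only their values on the basis are prescribed; off its span the linear extension is
  arbitrary.\<close>

definition Am :: "'h \<Rightarrow> 'h" where
  "Am = (SOME A. Vector_Spaces.linear (scale H) (scale H) A \<and>
    (\<forall>m<n. A (e m) = scale H (C m) (E (m + n - 1))))"

definition Ap :: "'h \<Rightarrow> 'h" where
  "Ap = (SOME A. Vector_Spaces.linear (scale H) (scale H) A \<and>
    (\<forall>m<n. A (e m) = scale H (cnj (C (Suc m))) (E (Suc m))))"

definition Z :: "'h \<Rightarrow> 'h" where
  "Z = (SOME A. Vector_Spaces.linear (scale H) (scale H) A \<and>
    (\<forall>m<n. A (e m) = scale H (of_real (sin (\<theta> m))) (e m)))"

lemma Am: "Vector_Spaces.linear (scale H) (scale H) Am"
    "\<forall>m<n. Am (e m) = scale H (C m) (E (m + n - 1))"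
  using someI_ex[of "\<lambda>A. Vector_Spaces.linear (scale H) (scale H) A \<and>
    (\<forall>m<n. A (e m) = scale H (C m) (E (m + n - 1)))"]
    linear_with_images[of "\<lambda>m. scale H (C m) (E (m + n - 1))"]
  unfolding Am_def by blast+

lemma Ap: "Vector_Spaces.linear (scale H) (scale H) Ap"
    "\<forall>m<n. Ap (e m) = scale H (cnj (C (Suc m))) (E (Suc m))"
  using someI_ex[of "\<lambda>A. Vector_Spaces.linear (scale H) (scale H) A \<and>
    (\<forall>m<n. A (e m) = scale H (cnj (C (Suc m))) (E (Suc m)))"]
    linear_with_images[of "\<lambda>m. scale H (cnj (C (Suc m))) (E (Suc m))"]
  unfolding Ap_def by blast+

lemma Z: "Vector_Spaces.linear (scale H) (scale H) Z"
    "\<forall>m<n. Z (e m) = scale H (of_real (sin (\<theta> m))) (e m)"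
  using someI_ex[of "\<lambda>A. Vector_Spaces.linear (scale H) (scale H) A \<and>
    (\<forall>m<n. A (e m) = scale H (of_real (sin (\<theta> m))) (e m))"]
    linear_with_images[of "\<lambda>m. scale H (of_real (sin (\<theta> m))) (e m)"]
  unfolding Z_def by blast+

sublocale Am: Vector_Spaces.linear "scale H" "scale H" Am by (rule Am)
sublocale Ap: Vector_Spaces.linear "scale H" "scale H" Ap by (rule Ap)
sublocale Z: Vector_Spaces.linear "scale H" "scale H" Z by (rule Z)

lemma Am_E: "Am (E (Suc m)) = scale H (C (Suc m)) (E m)"
proof -
  let ?j = "Suc m mod n"
  have "Am (E (Suc m)) = scale H (C ?j) (E (?j + n - 1))"
    using Am(2) n_pos by (simp add: E_def)
  moreover have "E (?j + n - 1) = E m"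
    using pred_mod_eq_iff[of ?j n "m mod n"] n_pos by (simp add: E_def mod_Suc_eq)
  ultimately show ?thesis by (simp add: C_mod)
qed

lemma Ap_E: "Ap (E m) = scale H (cnj (C (Suc m))) (E (Suc m))"
  using Ap(2) n_pos C_mod[of "Suc (m mod n)"] C_mod[of "Suc m"] by (simp add: E_def mod_Suc_eq)

lemma Z_E: "Z (E m) = scale H (of_real (sin (\<theta> m))) (E m)"
  using Z(2) n_pos by (simp add: E_def sin_\<theta>_mod)

text \<open>Testing at \<open>E (Suc m)\<close> lets the lowered vector be written
  \<open>E m\<close>. Every basis vector has this form, since \<open>Suc (m + n - 1)\<close> is m
  modulo n.\<close>

lemma linear_eq_on_E:
  assumes "Vector_Spaces.linear (scale H) (scale H) A" "Vector_Spaces.linear (scale H) (scale H) B"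
    and "\<And>m. A (E (Suc m)) = B (E (Suc m))" and "v \<in> vecs H"
  shows "A v = B v"
proof (rule linear_eq_on_vecs[OF assms(1,2) _ assms(4)])
  fix m assume "m < n"
  then have "e m = E (Suc (m + n - 1))" using n_pos by (simp add: E_def)
  then show "A (e m) = B (e m)" using assms(3) by simp
qed

lemma Am_mem [simp]: "v \<in> vecs H \<Longrightarrow> Am v \<in> vecs H"
  using Am(1) by (rule linear_vecs) (simp_all add: Am(2))

lemma Ap_mem [simp]: "v \<in> vecs H \<Longrightarrow> Ap v \<in> vecs H"
  using Ap(1) by (rule linear_vecs) (simp_all add: Ap(2))

lemma Z_mem [simp]: "v \<in> vecs H \<Longrightarrow> Z v \<in> vecs H"
  using Z(1) by (rule linear_vecs) (simp_all add: Z(2))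

lemma inner_Am: "v \<in> vecs H \<Longrightarrow> w \<in> vecs H \<Longrightarrow> inner H (Am v) w = inner H v (Ap w)"
proof -
  have "is_adjoint H Am Ap"
  proof (rule is_adjointI[OF Am(1) Ap(1)])
    fix l m assume lm: "l < n" "m < n"
    have "inner H (e ((l + n - 1) mod n)) (e m) = inner H (e l) (e (Suc m mod n))"
      using pred_mod_eq_iff[OF lm] lm n_pos by (simp add: inner_e)
    \<comment> \<open>Unless the matrix entry vanishes, l is \<open>Suc m\<close> modulo n, and then
      periodicity identifies the two coefficients, also at the wrap-around.\<close>
    moreover have "inner H (e l) (e (Suc m mod n)) = 0 \<or> C l = C (Suc m)"
      using lm n_pos by (auto simp: inner_e C_mod)
    ultimately show "inner H (Am (e l)) (e m) = inner H (e l) (Ap (e m))"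
      using lm n_pos by (auto simp: Am(2) Ap(2) inner_scale_left inner_scale_right E_def)
  qed simp_all
  then show "v \<in> vecs H \<Longrightarrow> w \<in> vecs H \<Longrightarrow> inner H (Am v) w = inner H v (Ap w)"
    by (simp add: is_adjoint_def)
qed

lemma inner_Ap: "v \<in> vecs H \<Longrightarrow> w \<in> vecs H \<Longrightarrow> inner H (Ap v) w = inner H v (Am w)"
  using inner_Am[of w v] inner_commute[of "Am w" v] inner_commute[of w "Ap v"] by simp

lemma is_adjoint_Z: "is_adjoint H Z Z"
  by (rule is_adjointI[OF Z(1) Z(1)])
    (auto simp: Z(2) inner_scale_left inner_scale_right inner_e)

fun T :: "generator \<Rightarrow> 'h \<Rightarrow> 'h" where
  "T GX v = scale H (1 / 2) (Ap v + Am v)"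
| "T GY v = scale H (\<i> / 2) (Am v - Ap v)"
| "T GZ v = Z v"
| "T GEps v = scale H (of_real (tan (\<alpha> / 2))) v"
| "T GInv v = scale H (of_real (1 / (1 + (tan (\<alpha> / 2))\<^sup>2))) v"

lemma linear_T: "Vector_Spaces.linear (scale H) (scale H) (T g)"
  unfolding Vector_Spaces.linear_iff
  by (cases g)
    (simp_all add: vector_space_axioms Ap.add Am.add Z.add Ap.scale Am.scale Z.scale
      scale_right_distrib scale_right_diff_distrib mult.commute algebra_simps)

sublocale generator_action "scale H" T
  by (intro generator_action.intro generator_action_axioms.intro vector_space_axioms linear_T)

lemma T_mem: "v \<in> vecs H \<Longrightarrow> T g v \<in> vecs H"
  by (cases g) simp_all

lemma is_adjoint_T: "is_adjoint H (T g) (T g)"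
  unfolding is_adjoint_def using is_adjoint_Z[unfolded is_adjoint_def]
  by (cases g) (auto simp: inner_scale_left inner_scale_right inner_add_left inner_add_right
      inner_diff_left inner_diff_right inner_Am inner_Ap algebra_simps)

section \<open>The defining relations on the basis\<close>

lemma C_square:
  "C (Suc m) * cnj (C (Suc m)) = of_real (inverse (cos (\<alpha> / 2)) * cos (\<theta> (Suc m) - \<alpha> / 2) + R)"
  "C (Suc (Suc m)) * cnj (C (Suc (Suc m))) =
    of_real (inverse (cos (\<alpha> / 2)) * cos (\<theta> (Suc m) + \<alpha> / 2) + R)"
proof -
  have "\<beta> - \<alpha> / 2 + real (Suc m) * \<alpha> = \<theta> (Suc m) - \<alpha> / 2"
    "\<beta> - \<alpha> / 2 + real (Suc (Suc m)) * \<alpha> = \<theta> (Suc m) + \<alpha> / 2"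
    by (simp_all add: \<theta>_def algebra_simps)
  then show "C (Suc m) * cnj (C (Suc m)) = of_real (inverse (cos (\<alpha> / 2)) * cos (\<theta> (Suc m) - \<alpha> / 2) + R)"
    "C (Suc (Suc m)) * cnj (C (Suc (Suc m))) =
      of_real (inverse (cos (\<alpha> / 2)) * cos (\<theta> (Suc m) + \<alpha> / 2) + R)"
    unfolding complex_norm_square[symmetric] C_norm by metis+
qed

text \<open>The terms that shift twice cancel, so x^2 + y^2 is diagonal in the basis; the same
  cancellation makes [x,y] diagonal below.\<close>

lemma T_XX_YY:
  "T GX (T GX v) + T GY (T GY v) = scale H (1 / 2) (Ap (Am v) + Am (Ap v))"
proof -
  have 1: "T GX (T GX v) = scale H (1 / 4) (Ap (Ap v) + Ap (Am v) + (Am (Ap v) + Am (Am v)))"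
    by (simp add: Ap.scale Ap.add Am.scale Am.add scale_right_distrib)
  have 2: "T GY (T GY v) = scale H (- 1 / 4) (Ap (Ap v) - Ap (Am v) - (Am (Ap v) - Am (Am v)))"
    by (simp add: Ap.scale Ap.diff Am.scale Am.diff scale_right_diff_distrib)
  have 3: "scale H (1 / 2) x = scale H (1 / 4) x + scale H (1 / 4) x" for x
    by (simp add: scale_left_distrib[symmetric])
  show ?thesis
    unfolding 1 2 3 by (simp add: scale_right_distrib scale_right_diff_distrib algebra_simps)
qed

lemma T_XY_YX:
  "T GX (T GY v) - T GY (T GX v) = scale H (\<i> / 2) (Ap (Am v) - Am (Ap v))"
proof -
  have 1: "T GX (T GY v) = scale H (- \<i> / 4) (Ap (Ap v) - Ap (Am v) + (Am (Ap v) - Am (Am v)))"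
    by (simp add: Ap.scale Ap.diff Am.scale Am.diff scale_right_distrib scale_right_diff_distrib)
  have 2: "T GY (T GX v) = scale H (- \<i> / 4) (Ap (Ap v) + Ap (Am v) - (Am (Ap v) + Am (Am v)))"
    by (simp add: Ap.scale Ap.add Am.scale Am.add scale_right_distrib scale_right_diff_distrib)
  have 3: "scale H (\<i> / 2) x = scale H (\<i> / 4) x + scale H (\<i> / 4) x" for x
    by (simp add: scale_left_distrib[symmetric])
  show ?thesis
    unfolding 1 2 3 by (simp add: scale_right_distrib scale_right_diff_distrib algebra_simps)
qed

lemma Ap_Am_E: "Ap (Am (E (Suc m))) = scale H (C (Suc m) * cnj (C (Suc m))) (E (Suc m))"
  by (simp add: Am_E Ap.scale Ap_E)

lemma Am_Ap_E: "Am (Ap (E m)) = scale H (C (Suc m) * cnj (C (Suc m))) (E m)"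
  by (simp add: Am_E Am.scale Ap_E mult.commute)

text \<open>The two weights adjacent to a basis vector are centred at its angle, at distance
  \<alpha>/2 on either side. Their cosines add up to 2 cos \<theta> cos(\<alpha>/2), whose second
  factor cancels the secant.\<close>

lemma act_w_E_Suc: "act (w_free R) (E (Suc m)) = scale H (of_real (cos (\<theta> (Suc m)))) (E (Suc m))"
proof -
  have "act (w_free R) (E (Suc m))
      = scale H (1 / 2 * (C (Suc m) * cnj (C (Suc m)) + C (Suc (Suc m)) * cnj (C (Suc (Suc m)))) - of_real R) (E (Suc m))"
    by (simp add: w_free_def power2_eq_square act_minus act_add act_mult T_XX_YY Ap_Am_E Am_Ap_E
        scale_left_distrib scale_left_diff_distrib scale_right_distrib add_divide_distrib del: T.simps)
  also have "1 / 2 * (C (Suc m) * cnj (C (Suc m)) + C (Suc (Suc m)) * cnj (C (Suc (Suc m)))) - of_real R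
      = complex_of_real (1 / 2 * ((inverse (cos (\<alpha> / 2)) * cos (\<theta> (Suc m) - \<alpha> / 2) + R)
          + (inverse (cos (\<alpha> / 2)) * cos (\<theta> (Suc m) + \<alpha> / 2) + R)) - R)"
    unfolding C_square(1)[of m] C_square(2)[of m] by simp
  also have "1 / 2 * ((inverse (cos (\<alpha> / 2)) * cos (\<theta> (Suc m) - \<alpha> / 2) + R)
          + (inverse (cos (\<alpha> / 2)) * cos (\<theta> (Suc m) + \<alpha> / 2) + R)) - R = cos (\<theta> (Suc m))"
    unfolding cos_add cos_diff
    using cos_half_pos by (simp add: divide_simps)
  finally show ?thesis .
qed

lemma act_w_E: "act (w_free R) (E m) = scale H (of_real (cos (\<theta> m))) (E m)"
proof -
  have "E m = E (Suc (m + n - 1))" "cos (\<theta> m) = cos (\<theta> (Suc (m + n - 1)))"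
    using n_pos cos_\<theta>_mod[of m] cos_\<theta>_mod[of "m + n"] by (simp_all add: E_period)
  then show ?thesis by (simp only: act_w_E_Suc)
qed

text \<open>Here the same two weights are subtracted: R drops out and the difference is 2
  tan(\<alpha>/2) sin \<theta>.\<close>

lemma act_xy_E:
  "act (gen GX * gen GY - gen GY * gen GX - const \<i> * gen GEps * gen GZ) (E (Suc m)) = 0"
proof -
  have "act (gen GX * gen GY - gen GY * gen GX - const \<i> * gen GEps * gen GZ) (E (Suc m))
      = scale H (\<i> / 2) (Ap (Am (E (Suc m))) - Am (Ap (E (Suc m))))
        - scale H (\<i> * of_real (tan (\<alpha> / 2)) * of_real (sin (\<theta> (Suc m)))) (E (Suc m))"
    unfolding T_XY_YX[symmetric] by (simp add: act_minus act_mult Z_E del: T.simps(1,2))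
  also have "\<dots> = scale H (\<i> / 2 * (C (Suc m) * cnj (C (Suc m)) - C (Suc (Suc m)) * cnj (C (Suc (Suc m))))
        - \<i> * of_real (tan (\<alpha> / 2)) * of_real (sin (\<theta> (Suc m)))) (E (Suc m))"
    by (simp add: Ap_Am_E Am_Ap_E scale_left_diff_distrib scale_right_diff_distrib right_diff_distrib)
  also have "\<i> / 2 * (C (Suc m) * cnj (C (Suc m)) - C (Suc (Suc m)) * cnj (C (Suc (Suc m))))
        - \<i> * of_real (tan (\<alpha> / 2)) * of_real (sin (\<theta> (Suc m)))
      = \<i> * of_real (1 / 2 * ((inverse (cos (\<alpha> / 2)) * cos (\<theta> (Suc m) - \<alpha> / 2) + R)
          - (inverse (cos (\<alpha> / 2)) * cos (\<theta> (Suc m) + \<alpha> / 2) + R))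
          - tan (\<alpha> / 2) * sin (\<theta> (Suc m)))"
    unfolding C_square(1)[of m] C_square(2)[of m] by (simp add: algebra_simps)
  also have "1 / 2 * ((inverse (cos (\<alpha> / 2)) * cos (\<theta> (Suc m) - \<alpha> / 2) + R)
          - (inverse (cos (\<alpha> / 2)) * cos (\<theta> (Suc m) + \<alpha> / 2) + R))
          - tan (\<alpha> / 2) * sin (\<theta> (Suc m)) = 0"
    unfolding cos_add cos_diff tan_def
    using cos_half_pos by (simp add: divide_simps)
  finally show ?thesis by simp
qed

lemma T_X_E: "T GX (E (Suc m)) =
    scale H (cnj (C (Suc (Suc m))) / 2) (E (Suc (Suc m))) + scale H (C (Suc m) / 2) (E m)"
  by (simp add: Ap_E Am_E scale_right_distrib)

lemma T_Y_E: "T GY (E (Suc m)) =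
    scale H (\<i> * C (Suc m) / 2) (E m) - scale H (\<i> * cnj (C (Suc (Suc m))) / 2) (E (Suc (Suc m)))"
  by (simp add: Ap_E Am_E scale_right_diff_distrib)

text \<open>Only the raised and the lowered vector occur, and the coefficient of each contains an
  instance of \<open>sin_step\<close>, one for the step up and one for the step down.\<close>

lemma act_yz_E:
  "act (gen GY * gen GZ - gen GZ * gen GY
    - const \<i> * gen GEps * (w_free R * gen GX + gen GX * w_free R)) (E (Suc m)) = 0"
proof -
  let ?P = "E (Suc (Suc m))" and ?Q = "E m"
    and ?c = "cnj (C (Suc (Suc m)))" and ?d = "C (Suc m)"
  \<comment> \<open>Trigonometric values are hidden behind complex atoms, which makes the regrouping
    by basis vector pure polynomial algebra.\<close>
  define s0 s1 s2 c0 c1 c2 t where d: "s0 = complex_of_real (sin (\<theta> m))"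
    "s1 = complex_of_real (sin (\<theta> (Suc m)))" "s2 = complex_of_real (sin (\<theta> (Suc (Suc m))))"
    "c0 = complex_of_real (cos (\<theta> m))" "c1 = complex_of_real (cos (\<theta> (Suc m)))"
    "c2 = complex_of_real (cos (\<theta> (Suc (Suc m))))" "t = complex_of_real (tan (\<alpha> / 2))"
  have step: "s1 - s0 = t * (c1 + c0)" "s2 - s1 = t * (c2 + c1)"
    using sin_step[of m] sin_step[of "Suc m"]
    unfolding d of_real_diff[symmetric] of_real_add[symmetric] of_real_mult[symmetric] by simp_all
  have "act (gen GY * gen GZ - gen GZ * gen GY
    - const \<i> * gen GEps * (w_free R * gen GX + gen GX * w_free R)) (E (Suc m))
    = scale H s1 (scale H (\<i> * ?d / 2) ?Q - scale H (\<i> * ?c / 2) ?P)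
      - (scale H (\<i> * ?d / 2) (scale H s0 ?Q) - scale H (\<i> * ?c / 2) (scale H s2 ?P))
      - scale H \<i> (scale H t ((scale H (?c / 2) (scale H c2 ?P) + scale H (?d / 2) (scale H c0 ?Q))
          + scale H c1 (scale H (?c / 2) ?P + scale H (?d / 2) ?Q)))"
    unfolding act_minus act_add act_mult act_gen act_const T_X_E T_Y_E T.simps(3,4) Z_E act_w_E
      Z.add Z.diff Z.scale act.add[where f = "w_free R"] act.diff[where f = "w_free R"]
      act.scale[where f = "w_free R"] T.scale[where g = GX] T.scale[where g = GY] d
    by (simp only: T_X_E T_Y_E)
  also have "\<dots> = scale H (?c * \<i> / 2 * ((s2 - s1) - t * (c2 + c1))) ?P
      + scale H (?d * \<i> / 2 * ((s1 - s0) - t * (c1 + c0))) ?Q"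
    by (simp add: scale_right_distrib scale_right_diff_distrib scale_left_distrib
        scale_left_diff_distrib ring_distribs add_divide_distrib diff_divide_distrib)
      (simp add: algebra_simps)
  also have "\<dots> = 0"
    unfolding step by simp
  finally show ?thesis .
qed

text \<open>The same two instances of \<open>sin_step\<close> suffice: together with the previous
  relation this amounts to [z, a_+] = eps (w a_+ + a_+ w) and its adjoint.\<close>

lemma act_zx_E:
  "act (gen GZ * gen GX - gen GX * gen GZ
    - const \<i> * gen GEps * (w_free R * gen GY + gen GY * w_free R)) (E (Suc m)) = 0"
proof -
  let ?P = "E (Suc (Suc m))" and ?Q = "E m"
    and ?c = "cnj (C (Suc (Suc m)))" and ?d = "C (Suc m)"
  define s0 s1 s2 c0 c1 c2 t where d: "s0 = complex_of_real (sin (\<theta> m))"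
    "s1 = complex_of_real (sin (\<theta> (Suc m)))" "s2 = complex_of_real (sin (\<theta> (Suc (Suc m))))"
    "c0 = complex_of_real (cos (\<theta> m))" "c1 = complex_of_real (cos (\<theta> (Suc m)))"
    "c2 = complex_of_real (cos (\<theta> (Suc (Suc m))))" "t = complex_of_real (tan (\<alpha> / 2))"
  have step: "s1 - s0 = t * (c1 + c0)" "s2 - s1 = t * (c2 + c1)"
    using sin_step[of m] sin_step[of "Suc m"]
    unfolding d of_real_diff[symmetric] of_real_add[symmetric] of_real_mult[symmetric] by simp_all
  have "act (gen GZ * gen GX - gen GX * gen GZ
    - const \<i> * gen GEps * (w_free R * gen GY + gen GY * w_free R)) (E (Suc m))
    = (scale H (?c / 2) (scale H s2 ?P) + scale H (?d / 2) (scale H s0 ?Q))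
      - scale H s1 (scale H (?c / 2) ?P + scale H (?d / 2) ?Q)
      - scale H \<i> (scale H t ((scale H (\<i> * ?d / 2) (scale H c0 ?Q) - scale H (\<i> * ?c / 2) (scale H c2 ?P))
          + scale H c1 (scale H (\<i> * ?d / 2) ?Q - scale H (\<i> * ?c / 2) ?P)))"
    unfolding act_minus act_add act_mult act_gen act_const T_X_E T_Y_E T.simps(3,4) Z_E act_w_E
      Z.add Z.diff Z.scale act.add[where f = "w_free R"] act.diff[where f = "w_free R"]
      act.scale[where f = "w_free R"] T.scale[where g = GX] T.scale[where g = GY] d
    by (simp only: T_X_E T_Y_E)
  also have "\<dots> = scale H (?c / 2 * ((s2 - s1) - t * (c2 + c1))) ?P
      - scale H (?d / 2 * ((s1 - s0) - t * (c1 + c0))) ?Q"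
    by (simp add: scale_right_distrib scale_right_diff_distrib scale_left_distrib
        scale_left_diff_distrib ring_distribs add_divide_distrib diff_divide_distrib)
      (simp add: algebra_simps)
  also have "\<dots> = 0"
    unfolding step by simp
  finally show ?thesis .
qed

lemma act_sphere_E: "act (gen GZ ^ 2 + w_free R ^ 2 - 1) (E m) = 0"
proof -
  have "act (gen GZ ^ 2 + w_free R ^ 2 - 1) (E m)
     = scale H (of_real ((sin (\<theta> m))\<^sup>2 + (cos (\<theta> m))\<^sup>2)) (E m) - E m"
    by (simp add: act_minus act_add act_mult power2_eq_square act_w_E Z_E Z.scale act.scale
      scale_left_distrib del: sin_cos_squared_add)
  then show ?thesis by simp
qed

lemma act_relators:
  assumes r: "r \<in> relators R" and v: "v \<in> vecs H"
  shows "act r v = 0"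
proof -
  have basis: "act r v = 0" if "\<And>m. act r (E (Suc m)) = 0"
  proof (rule linear_eq_on_E[OF act.linear_axioms _ _ v])
    show "Vector_Spaces.linear (scale H) (scale H) (\<lambda>_. 0 :: 'h)"
      by (simp add: Vector_Spaces.linear_iff vector_space_axioms)
  qed (rule that)
  \<comment> \<open>A real number 1 + tan^2 cannot vanish, so the scalar assigned to
    \<open>GInv\<close> is a genuine inverse.\<close>
  define a where "a = 1 + (tan (\<alpha> / 2))\<^sup>2"
  have "a \<noteq> 0"
    unfolding a_def by (metis add_pos_nonneg less_irrefl zero_le_power2 zero_less_one)
  then have inv: "scale H (of_real a) (scale H (of_real (1 / a)) v) = v"
    "scale H (of_real (1 / a)) (scale H (of_real a) v) = v"
    unfolding scale_scale of_real_mult[symmetric] by simp_all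
  have eps: "act (1 + gen GEps ^ 2) x = scale H (of_real a) x" for x
    by (simp add: act_add act_mult power2_eq_square scale_left_distrib a_def)
  show ?thesis
    using r unfolding relators_def
  proof (elim UnE insertE emptyE rangeE)
    fix g assume "r = gen GEps * gen g - gen g * gen GEps"
    then show ?thesis by (simp add: act_minus act_mult T.scale)
  next
    assume "r = (1 + gen GEps ^ 2) * gen GInv - 1"
    then show ?thesis
      by (simp only: act_minus act_mult eps act_gen T.simps a_def[symmetric] inv act_one) simp
  next
    assume "r = gen GInv * (1 + gen GEps ^ 2) - 1"
    then show ?thesis
      by (simp only: act_minus act_mult eps act_gen T.simps a_def[symmetric] inv act_one) simp
  qed (rule basis; simp only: act_xy_E act_yz_E act_zx_E act_sphere_E)+
qed

sublocale algebra_action R H T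
  by unfold_locales (use T_mem act_relators subspace_vecs in auto)

end

section \<open>Spectrum of u and irreducibility\<close>

context shift_model
begin

abbreviation U :: "'h \<Rightarrow> 'h" where
  "U \<equiv> induced (u_elt R)"

definition ev :: "nat \<Rightarrow> complex" where
  "ev m = exp (\<i> * of_real (\<beta> + real m * \<alpha>))"

lemma U_act: "v \<in> vecs H \<Longrightarrow> U v = act (w_free R + const \<i> * gen GZ) v"
  by (simp add: u_elt_def induced_cls)

lemma U_mem: "v \<in> vecs H \<Longrightarrow> U v \<in> vecs H"
  by (simp add: U_act act_vecs)

lemma ev_eq: "ev m = of_real (cos (\<theta> m)) + \<i> * of_real (sin (\<theta> m))"
  by (simp add: ev_def \<theta>_def cis_conv_exp[symmetric] complex_eq_iff del: of_real_add of_real_mult)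

lemma U_E: "U (E m) = scale H (ev m) (E m)"
  by (simp add: U_act act_add act_mult act_w_E Z_E ev_eq scale_left_distrib)

lemma U_e: "m < n \<Longrightarrow> U (e m) = scale H (ev m) (e m)"
  using U_E[of m] by (simp add: E_less)

lemma inner_U:
  assumes "v \<in> vecs H" "m < n"
  shows "inner H (e m) (U v) = ev m * inner H (e m) v"
proof -
  let ?c = "\<lambda>l. inner H (e l) v"
  have "U v = act (w_free R + const \<i> * gen GZ) (\<Sum>l<n. scale H (?c l) (e l))"
    using assms(1) by (simp only: U_act expansion[OF assms(1), symmetric])
  also have "\<dots> = (\<Sum>l<n. scale H (?c l) (act (w_free R + const \<i> * gen GZ) (e l)))"
    by (simp add: act.sum act.scale)
  also have "\<dots> = (\<Sum>l<n. scale H (ev l * ?c l) (e l))"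
  proof (intro sum.cong refl)
    fix l assume "l \<in> {..<n}"
    then show "scale H (?c l) (act (w_free R + const \<i> * gen GZ) (e l)) = scale H (ev l * ?c l) (e l)"
      using U_e[of l] U_act[of "e l"] by (simp add: mult.commute)
  qed
  finally show ?thesis
    using inner_orthonormal_sum[of n e m "\<lambda>l. ev l * ?c l"] assms(2) inner_e by simp
qed

text \<open>Equal eigenvalues force n to divide (l - m) k; coprimality removes k, and |l - m| < n
  leaves only l = m.\<close>

lemma ev_inj:
  assumes "l < n" "m < n" "ev l = ev m"
  shows "l = m"
proof -
  have "cos (\<theta> l) = cos (\<theta> m)" "sin (\<theta> l) = sin (\<theta> m)"
    using arg_cong[OF assms(3), of Re] arg_cong[OF assms(3), of Im] by (simp_all add: ev_eq)
  then obtain j :: int where "\<theta> l = \<theta> m + 2 * pi * j"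
    using sin_cos_eq_iff by blast
  then have "(real l - real m) * \<alpha> = 2 * pi * j"
    by (simp add: \<theta>_def algebra_simps)
  then have "(real l - real m) * (real n * \<alpha>) = 2 * pi * j * real n"
    by (metis mult.assoc mult.commute)
  then have "2 * pi * ((real l - real m) * real k) = 2 * pi * (j * real n)"
    unfolding n_alpha by (simp only: mult_ac)
  then have "(real l - real m) * real k = j * real n"
    using pi_gt_zero mult_cancel_left[of "2 * pi"] by simp
  then have "real_of_int ((int l - int m) * int k) = real_of_int (j * int n)"
    by simp
  then have "(int l - int m) * int k = j * int n"
    by (simp only: of_int_eq_iff)
  then have "int n dvd (int l - int m) * int k" by simp
  moreover have "coprime (int n) (int k)"
    using coprime_nk by simp
  ultimately have "int n dvd int l - int m"
    using coprime_dvd_mult_left_iff by blast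
  then show "l = m"
    using assms(1,2) dvd_imp_le_int[of "int l - int m" "int n"] by linarith
qed

text \<open>The j-th iterate of U - c multiplies the m-th coordinate by
  \<open>(ev m - c) ^ j\<close>. A generalized eigenvector therefore has no coordinates outside the
  eigenvalue c, and \<open>ev_inj\<close> leaves at most one index.\<close>

lemma no_multiple_eigenvalues_U: "no_multiple_eigenvalues H U"
  unfolding no_multiple_eigenvalues_def
proof
  fix c
  let ?f = "\<lambda>x. U x - scale H c x"
  let ?S = "{v \<in> vecs H. \<exists>j. (?f ^^ j) v = 0}"
  have iter: "(?f ^^ j) v \<in> vecs H \<and>
      (\<forall>m<n. inner H (e m) ((?f ^^ j) v) = (ev m - c) ^ j * inner H (e m) v)"
    if "v \<in> vecs H" for v j
    using that by (induction j)
      (simp_all add: U_mem inner_diff_right inner_U inner_scale_right left_diff_distrib)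
  have coef: "inner H (e m) v = 0" if "v \<in> ?S" "m < n" "ev m \<noteq> c" for v m
  proof -
    obtain j where j: "v \<in> vecs H" "(?f ^^ j) v = 0" using \<open>v \<in> ?S\<close> by blast
    then have "(ev m - c) ^ j * inner H (e m) v = 0"
      using iter[OF j(1), of j] that(2) by simp
    then show ?thesis using that(3) by simp
  qed
  define B where "B = e ` {m. m < n \<and> ev m = c}"
  have "?S \<subseteq> span B"
  proof
    fix v assume v: "v \<in> ?S"
    then have "v = (\<Sum>m<n. scale H (inner H (e m) v) (e m))"
      using expansion by blast
    moreover have "(\<Sum>m<n. scale H (inner H (e m) v) (e m)) \<in> span B"
    proof (intro span_sum)
      fix m assume m: "m \<in> {..<n}"
      show "scale H (inner H (e m) v) (e m) \<in> span B"
      proof (cases "ev m = c")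
        case True
        then show ?thesis using m by (intro span_scale span_base) (auto simp: B_def)
      qed (use coef[OF v, of m] m in \<open>simp add: span_zero\<close>)
    qed
    ultimately show "v \<in> span B" by argo
  qed
  moreover have "card {m. m < n \<and> ev m = c} \<le> 1"
    by (subst One_nat_def, subst card_le_Suc0_iff_eq) (auto intro: ev_inj)
  then have "finite B" "card B \<le> 1"
    using card_image_le[of "{m. m < n \<and> ev m = c}" e] by (auto simp: B_def)
  ultimately show "dim ?S \<le> 1"
    using dim_le_card[of ?S B] by simp
qed

lemma a_plus_E: "induced (a_plus R) (E m) = scale H (cnj (C (Suc m))) (E (Suc m))"
proof -
  have "induced (a_plus R) (E m) = scale H (1 / 2) (Ap (E m)) + scale H (1 / 2) (Ap (E m))"
    by (simp add: a_plus_def induced_cls act_add act_mult scale_right_distrib scale_right_diff_distrib)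
  also have "\<dots> = Ap (E m)"
    by (simp add: scale_left_distrib[symmetric])
  finally show ?thesis by (simp add: Ap_E)
qed

lemma a_minus_E: "induced (a_minus R) (E (Suc m)) = scale H (C (Suc m)) (E m)"
proof -
  have "induced (a_minus R) (E (Suc m)) = scale H (1 / 2) (Am (E (Suc m))) + scale H (1 / 2) (Am (E (Suc m)))"
    by (simp add: a_minus_def induced_cls act_minus act_mult scale_right_distrib scale_right_diff_distrib)
  also have "\<dots> = Am (E (Suc m))"
    by (simp add: scale_left_distrib[symmetric])
  finally show ?thesis by (simp add: Am_E)
qed

text \<open>A nonzero vector of an invariant subspace with the fewest nonzero coordinates is a multiple
  of a basis vector, since otherwise \<open>u\<close> minus one of its eigenvalues would shorten it.\<close>

lemma invariant_subspace_contains_basis_vector: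
  assumes W: "subspace W" "W \<subseteq> vecs H" "W \<noteq> {0}"
    and inv: "\<And>v. v \<in> W \<Longrightarrow> U v \<in> W"
  shows "\<exists>m<n. e m \<in> W"
proof -
  define supp where "supp v = {m. m < n \<and> inner H (e m) v \<noteq> 0}" for v
  have fin: "finite (supp v)" for v by (simp add: supp_def)
  obtain v0 where v0: "v0 \<in> W" "v0 \<noteq> 0"
    using W(1,3) subspace_0 by blast
  obtain v where v: "v \<in> W" "v \<noteq> 0" and min: "\<And>w. w \<in> W \<Longrightarrow> w \<noteq> 0 \<Longrightarrow> card (supp v) \<le> card (supp w)"
    using exists_least_iff[of "\<lambda>c. \<exists>v. v \<in> W \<and> v \<noteq> 0 \<and> card (supp v) = c"] v0
    by (metis not_less)
  have vH: "v \<in> vecs H" using v W(2) by blast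
  obtain m where m: "m < n" "inner H (e m) v \<noteq> 0"
    using vec_eq_0I[OF vH] v(2) by blast
  define w where "w = U v - scale H (ev m) v"
  have w: "w \<in> W"
    unfolding w_def by (intro subspace_diff[OF W(1)] subspace_scale[OF W(1)] inv v)
  have coef: "inner H (e l) w = (ev l - ev m) * inner H (e l) v" if "l < n" for l
    using that vH by (simp add: w_def inner_diff_right inner_scale_right inner_U U_mem left_diff_distrib)
  have "m \<in> supp v" "m \<notin> supp w"
    using m coef[of m] by (simp_all add: supp_def)
  moreover have "supp w \<subseteq> supp v"
  proof
    fix l assume "l \<in> supp w"
    then show "l \<in> supp v" using coef[of l] by (simp add: supp_def)
  qed
  ultimately have "supp w \<subset> supp v" by blast
  then have "card (supp w) < card (supp v)"
    by (intro psubset_card_mono fin)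
  then have "w = 0" using min[OF w] by (meson not_less)
  have zero: "inner H (e l) v = 0" if "l < n" "l \<noteq> m" for l
    using coef[OF that(1)] ev_inj[OF that(1) m(1)] that by (fastforce simp: \<open>w = 0\<close>)
  have "v = (\<Sum>l<n. scale H (inner H (e l) v) (e l))"
    by (rule expansion[OF vH])
  also have "\<dots> = (\<Sum>l<n. if l = m then scale H (inner H (e m) v) (e m) else 0)"
    by (intro sum.cong refl) (auto simp: zero)
  also have "\<dots> = scale H (inner H (e m) v) (e m)"
    using m(1) by simp
  finally have "scale H (inverse (inner H (e m) v)) v = e m"
    using m(2) by (metis scale_scale left_inverse scale_one)
  then have "e m \<in> W"
    using subspace_scale[OF W(1) v(1), of "inverse (inner H (e m) v)"] by simp
  with m(1) show ?thesis by blast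
qed

text \<open>Once one basis vector lies in the subspace, a_+ carries it around the whole cycle, since
  no weight vanishes.\<close>

lemma irreducible_induced: "irreducible_rep R H induced"
  unfolding irreducible_rep_def
proof (intro conjI allI impI representation_induced)
  show "vecs H \<noteq> {0}"
    using e_mem[OF n_pos] inner_e[OF n_pos n_pos] by auto
next
  fix W assume W: "subspace W \<and> W \<subseteq> vecs H \<and> (\<forall>F\<in>carrier (alg R). \<forall>v\<in>W. induced F v \<in> W)"
  then have sub: "subspace W" and le: "W \<subseteq> vecs H" by simp_all
  have inv: "induced (cls R f) v \<in> W" if "v \<in> W" for f v
    using W that by (auto simp: carrier_alg)
  show "W = {0} \<or> W = vecs H"
  proof (rule disjCI)
    assume "W \<noteq> vecs H"
    show "W = {0}"
    proof (rule ccontr)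
      assume "W \<noteq> {0}"
      then obtain m where m: "m < n" "e m \<in> W"
        using invariant_subspace_contains_basis_vector[OF sub le] inv unfolding u_elt_def by metis
      have "E (m + j) \<in> W" for j
      proof (induction j)
        case 0
        then show ?case using m by (simp add: E_less)
      next
        case (Suc j)
        then have "scale H (cnj (C (Suc (m + j)))) (E (Suc (m + j))) \<in> W"
          unfolding a_plus_E[symmetric] a_plus_def by (rule inv)
        then have "scale H (inverse (cnj (C (Suc (m + j))))) (scale H (cnj (C (Suc (m + j)))) (E (Suc (m + j)))) \<in> W"
          by (rule subspace_scale[OF sub])
        then show ?case by (simp add: C_nonzero)
      qed
      \<comment> \<open>The sum of the indices is l + n; the additional n keeps the subtraction of m
        from truncating.\<close>
      moreover have "e l = E (m + (l + n - m))" if "l < n" for l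
        using that m by (simp add: E_def)
      ultimately have "e ` {..<n} \<subseteq> W" by (metis image_subsetI lessThan_iff)
      then have "vecs H \<subseteq> W"
        using span_minimal[OF _ sub] span_e by metis
      then show False using le \<open>W \<noteq> vecs H\<close> by simp
    qed
  qed
qed

lemma T2_rep_induced:
  assumes k: "1 \<le> k" "real k < real n / 2" and \<nu>: "cmod \<nu> = 1"
    and C_prod: "\<nu> = (\<Prod>m<n. C m) / of_real (cmod (\<Prod>m<n. C m))"
  shows "T2_rep R n k \<beta> \<nu> H induced"
proof -
  have \<alpha>: "\<alpha> = 2 * pi * real k / real n"
    using n_alpha n_pos by (simp add: field_simps)
  have tan: "tan (\<alpha> / 2) > 0"
    using alpha by (intro tan_gt_zero) auto
  have "admissible_rep R n (tan (\<alpha> / 2)) H induced"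
    unfolding admissible_rep_def
  proof (intro conjI ballI hilbert irreducible_induced tan no_multiple_eigenvalues_U)
    fix F assume "F \<in> carrier (alg R)"
    then show "is_adjoint H (induced F) (induced (dagger F))"
      by (intro is_adjoint_induced inner_add_right inner_scale_right inner_commute is_adjoint_T)
  next
    fix v assume "v \<in> vecs H"
    then show "induced (eps R) v = scale H (of_real (tan (\<alpha> / 2))) v"
      by (simp add: eps_def induced_cls)
  qed
  moreover have "induced (a_minus R) (e m) = scale H (C m) (e (m - 1))" if "1 \<le> m" "m \<le> n - 1" for m
    using a_minus_E[of "m - 1"] that by (simp add: E_less)
  moreover have "induced (a_plus R) (e m) = scale H (cnj (C (m + 1))) (e (m + 1))" if "m + 2 \<le> n" for m
    using a_plus_E[of m] that by (simp add: E_less)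
  \<comment> \<open>The cycle closes at index n, where \<open>E\<close> and \<open>C\<close> repeat
    their values at 0.\<close>
  moreover have "induced (a_minus R) (e 0) = scale H (C 0) (e (n - 1))"
    using a_minus_E[of "n - 1"] n_pos E_period[of 0] C_period[of 0] by (simp add: E_less)
  moreover have "induced (a_plus R) (e (n - 1)) = scale H (cnj (C 0)) (e 0)"
    using a_plus_E[of "n - 1"] n_pos E_period[of 0] C_period[of 0] by (simp add: E_less)
  ultimately show ?thesis
    unfolding T2_rep_def
    using k coprime_nk \<nu> alpha \<alpha> onb C_nonzero C_norm U_e[unfolded ev_def] C_prod by blast
qed

end

section \<open>The range of the phase\<close>

lemma cos_add_2pi_int: "cos (x + 2 * pi * of_int j) = cos x"
  by (simp add: cos_add)

lemma T2_rep_exists: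
  fixes H :: "('h::ab_group_add) hspace" and n :: nat
  assumes H: "hilbert_space_dim H n"
    and nk: "coprime n k" "1 \<le> k" "real k < real n / 2" and \<nu>: "cmod \<nu> = 1"
    and \<alpha>: "\<alpha> = 2 * pi * real k / real n"
    and pos: "\<And>m. m < n \<Longrightarrow> 0 < inverse (cos (\<alpha> / 2)) * cos (\<beta> - \<alpha> / 2 + real m * \<alpha>) + R"
  shows "\<exists>\<Psi>. T2_rep R n k \<beta> \<nu> H \<Psi>"
proof -
  have n: "0 < n" using nk by auto
  interpret finite_hilbert H n by unfold_locales (rule H)
  obtain e where e: "orthonormal_basis H n e"
    using orthonormal_basis_exists by blast
  define val where "val m = inverse (cos (\<alpha> / 2)) * cos (\<beta> - \<alpha> / 2 + real m * \<alpha>) + R" for m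
  \<comment> \<open>The whole phase \<nu> sits on the weight with index 0, and all others are
    positive, so the product has phase exactly \<nu>. The test modulo n keeps \<open>C\<close>
    periodic.\<close>
  define C where "C m = (if m mod n = 0 then \<nu> else 1) * complex_of_real (sqrt (val m))" for m
  have n_alpha: "real n * \<alpha> = 2 * pi * real k" using n \<alpha> by simp
  have val_period: "val (m + n) = val m" for m
  proof -
    have "\<beta> - \<alpha> / 2 + real (m + n) * \<alpha> = (\<beta> - \<alpha> / 2 + real m * \<alpha>) + 2 * pi * real k"
      using n_alpha by (simp add: distrib_right)
    then have "cos (\<beta> - \<alpha> / 2 + real (m + n) * \<alpha>) = cos (\<beta> - \<alpha> / 2 + real m * \<alpha>)"
      using cos_add_2pi_int[of "\<beta> - \<alpha> / 2 + real m * \<alpha>" "int k"] by (simp only: of_int_of_nat_eq)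
    then show ?thesis by (simp add: val_def)
  qed
  have val_pos: "0 < val m" for m
    using pos[of "m mod n", folded val_def] periodic_mod[of val n m, OF val_period] n by simp
  have norm_C: "cmod (C m) = sqrt (val m)" for m
    using \<nu> val_pos[of m] by (simp add: C_def norm_mult)
  have \<alpha>_less: "\<alpha> < pi"
    using n nk(3) by (simp add: \<alpha> field_simps)
  interpret shift_model H n e R \<alpha> \<beta> k C
  proof unfold_locales
    show "0 < \<alpha>" using n nk by (simp add: \<alpha>)
    show "C m \<noteq> 0" for m using norm_C[of m] val_pos[of m] by auto
    show "(cmod (C m))\<^sup>2 = inverse (cos (\<alpha> / 2)) * cos (\<beta> - \<alpha> / 2 + real m * \<alpha>) + R" for m
      using val_pos[of m] by (simp add: norm_C) (simp add: val_def)
    show "C (m + n) = C m" for m by (simp add: C_def val_period)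
  qed (use e n nk n_alpha \<alpha>_less in auto)
  define P where "P = (\<Prod>m<n. sqrt (val m))"
  have "(\<Prod>m<n. C m) = (\<Prod>m<n. (if m = 0 then \<nu> else 1) * complex_of_real (sqrt (val m)))"
    by (intro prod.cong) (auto simp: C_def)
  also have "\<dots> = \<nu> * complex_of_real P"
    using n by (simp add: prod.distrib P_def)
  finally have prod_C: "(\<Prod>m<n. C m) = \<nu> * complex_of_real P" .
  have "0 < P"
    using val_pos unfolding P_def by (intro prod_pos) simp
  then have "\<nu> = (\<Prod>m<n. C m) / complex_of_real (cmod (\<Prod>m<n. C m))"
    unfolding prod_C norm_mult \<nu> norm_of_real by simp
  then show ?thesis
    using T2_rep_induced nk \<nu> by blast
qed

section \<open>Residues, angles and the arc around pi\<close>

lemma multiple_mod_coprime: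
  fixes t :: int
  assumes "coprime n k" "0 < n"
  obtains m :: nat and j :: int where "m < n" "int m * int k = t + j * int n"
proof -
  have "gcd (int n) (int k) = 1" using assms by simp
  then obtain u v where uv: "u * int n + v * int k = 1"
    using bezout_int[of "int n" "int k"] by auto
  \<comment> \<open>The Bezout coefficient v inverts k modulo n.\<close>
  define m where "m = nat ((v * t) mod int n)"
  define q where "q = (v * t) div int n"
  have "int m = v * t - q * int n"
    using assms(2) by (simp add: m_def q_def minus_div_mult_eq_mod)
  then have "int m * int k = (v * t - q * int n) * int k" by simp
  also have "\<dots> = (v * int k) * t - q * int k * int n"
    by (simp add: algebra_simps)
  also have "v * int k = 1 - u * int n" using uv by simp
  finally have "int m * int k = t + (- u * t - q * int k) * int n"
    by (simp add: algebra_simps)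
  moreover have "m < n" using assms(2) by (simp add: m_def nat_less_iff)
  ultimately show ?thesis using that by blast
qed

text \<open>Trades steps of \<alpha> for equally spaced angles: k is invertible modulo n, so both
  families are the same set of angles up to full turns. From here on k enters only through
  cos(\<alpha>/2).\<close>

lemma all_multiples_iff_all_fractions:
  assumes nk: "coprime n k" "0 < n" and \<alpha>: "\<alpha> = 2 * pi * real k / real n"
  shows "(\<forall>m<n. P (cos (x + real m * \<alpha>))) \<longleftrightarrow> (\<forall>t::int. P (cos (x + 2 * pi * of_int t / real n)))"
proof (intro iffI allI impI)
  fix t :: int assume *: "\<forall>m<n. P (cos (x + real m * \<alpha>))"
  obtain m j where m: "m < n" "int m * int k = t + j * int n"
    using multiple_mod_coprime[OF nk] by blast
  have "real m * real k = of_int t + of_int j * real n"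
    using arg_cong[OF m(2), of real_of_int] by simp
  then have "real m * \<alpha> = 2 * pi * (of_int t + of_int j * real n) / real n"
    by (simp add: \<alpha> mult_ac)
  then have "x + real m * \<alpha> = (x + 2 * pi * of_int t / real n) + 2 * pi * of_int j"
    using nk(2) by (simp add: field_simps)
  then show "P (cos (x + 2 * pi * of_int t / real n))"
    using * m(1) cos_add_2pi_int by metis
next
  fix m assume "\<forall>t::int. P (cos (x + 2 * pi * of_int t / real n))"
  from this[rule_format, of "int (m * k)"] show "P (cos (x + real m * \<alpha>))"
    by (simp add: \<alpha> mult_ac)
qed

lemma exists_angle_near_pi:
  assumes "0 < n"
  obtains t :: int where "cos (x + 2 * pi * of_int t / real n) \<le> - cos (pi / real n)"
proof
  \<comment> \<open>At the real parameter \<open>r\<close> the angle would be exactly pi. Rounding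
    moves it by at most half the spacing 2 pi / n.\<close>
  define r where "r = (pi - x) * real n / (2 * pi)"
  define d where "d = 2 * pi / real n * (of_int (round r) - r)"
  have "\<bar>d\<bar> \<le> 2 * pi / real n * (1 / 2)"
    unfolding d_def abs_mult using of_int_round_abs_le[of r] by (intro mult_mono) simp_all
  then have d: "\<bar>d\<bar> \<le> pi / real n" by simp
  have "x + 2 * pi * of_int (round r) / real n = pi + d"
    using assms by (simp add: d_def r_def field_simps)
  then have "cos (x + 2 * pi * of_int (round r) / real n) = - cos \<bar>d\<bar>"
    by simp
  moreover have "pi / real n \<le> pi / 1"
    using assms by (intro divide_left_mono) auto
  then have "cos (pi / real n) \<le> cos \<bar>d\<bar>"
    using d by (intro cos_monotone_0_pi_le) auto
  ultimately show "cos (x + 2 * pi * of_int (round r) / real n) \<le> - cos (pi / real n)"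
    by simp
qed

text \<open>Under the normalisation of x the angles enclosing pi are x (t = 0) and x + 2 pi / n (t =
  1). They yield the upper and the lower bound, and all the others are farther from pi.\<close>

lemma all_fractions_avoid_arc_iff:
  fixes x D :: real
  assumes n: "3 \<le> n" and D: "0 \<le> D" "D < pi / real n"
    and x: "pi - 2 * pi / real n < x" "x \<le> pi"
  shows "(\<forall>t::int. - cos D < cos (x + 2 * pi * of_int t / real n)) \<longleftrightarrow>
    pi - 2 * pi / real n + D < x \<and> x < pi - D"
proof
  have "2 * pi / real n \<le> 2 * pi / 3"
    using n by (intro divide_left_mono) auto
  then have small: "0 < pi / real n" "2 * pi / real n < pi" "D < pi"
    using n D pi_gt_zero by auto
  have cosD: "- cos D = cos (pi - D)" by simp
  {
    assume *: "\<forall>t::int. - cos D < cos (x + 2 * pi * of_int t / real n)"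
    have "x < pi - D"
    proof (rule ccontr)
      assume "\<not> x < pi - D"
      then have "cos x \<le> cos (pi - D)" using x small D by (intro cos_monotone_0_pi_le) auto
      then show False using *[rule_format, of 0] by simp
    qed
    moreover have "pi - 2 * pi / real n + D < x"
    proof (rule ccontr)
      \<comment> \<open>Reflection keeps the cosine and brings an angle just above pi into [0, pi],
        where the cosine is monotone.\<close>
      define z where "z = 2 * pi - (x + 2 * pi / real n)"
      assume "\<not> pi - 2 * pi / real n + D < x"
      then have "cos z \<le> cos (pi - D)"
        using x small D unfolding z_def by (intro cos_monotone_0_pi_le) linarith+
      moreover have "cos z = cos (x + 2 * pi / real n)"
        by (simp add: z_def)
      ultimately show False using *[rule_format, of 1] by simp
    qed
    ultimately show "pi - 2 * pi / real n + D < x \<and> x < pi - D" by simp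
  next
    assume *: "pi - 2 * pi / real n + D < x \<and> x < pi - D"
    show "\<forall>t::int. - cos D < cos (x + 2 * pi * of_int t / real n)"
    proof
      fix t :: int
      define s where "s = t mod int n"
      have s: "0 \<le> s" "s \<le> int n - 1" "t = s + (t div int n) * int n"
        using n by (simp_all add: s_def)
      have "of_int t = of_int s + of_int (t div int n) * real n"
        using arg_cong[OF s(3), of real_of_int] by simp
      then have "x + 2 * pi * of_int t / real n = (x + 2 * pi * of_int s / real n) + 2 * pi * of_int (t div int n)"
        using n by (simp add: field_simps)
      then have eq: "cos (x + 2 * pi * of_int t / real n) = cos (x + 2 * pi * of_int s / real n)"
        by (simp only: cos_add_2pi_int)
      show "- cos D < cos (x + 2 * pi * of_int t / real n)"
      proof (cases "s = 0")
        case True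
        have "cos (pi - D) < cos x"
          using * x small D by (intro cos_monotone_0_pi) auto
        then show ?thesis unfolding eq cosD using True by simp
      next
        case False
        \<comment> \<open>For 1 \<le> s \<le> n - 1 the angle lies strictly between pi + D and 3 pi
          - D, that is, within pi - D of 2 pi.\<close>
        define z where "z = 2 * pi - (x + 2 * pi * of_int s / real n)"
        have "1 \<le> s" using False s(1) by simp
        then have "2 * pi * 1 / real n \<le> 2 * pi * of_int s / real n"
          by (intro divide_right_mono mult_left_mono) auto
        moreover have "real_of_int s \<le> real n - 1" using s(2) by linarith
        then have "2 * pi * of_int s / real n \<le> 2 * pi * (real n - 1) / real n"
          by (intro divide_right_mono mult_left_mono) auto
        moreover have "2 * pi * (real n - 1) / real n = 2 * pi - 2 * pi / real n"
          using n by (simp add: field_simps)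
        ultimately have "\<bar>z\<bar> < pi - D"
          using * small D unfolding z_def by linarith
        then have "cos (pi - D) < cos \<bar>z\<bar>"
          using D by (intro cos_monotone_0_pi) auto
        also have "cos \<bar>z\<bar> = cos (x + 2 * pi * of_int s / real n)"
          by (simp add: z_def)
        finally show ?thesis unfolding eq cosD .
      qed
    qed
  }
qed

text \<open>A nonzero C_m makes its prescribed squared modulus positive, and positivity of all of
  them is what the construction asks for. Multiplying by cos(\<alpha>/2) > 0 then clears the
  secant.\<close>

lemma T2_rep_exists_iff:
  fixes H :: "('h::ab_group_add) hspace" and n :: nat
  assumes H: "hilbert_space_dim H n"
    and nk: "coprime n k" "1 \<le> k" "real k < real n / 2" and \<nu>: "cmod \<nu> = 1"
    and \<alpha>: "\<alpha> = 2 * pi * real k / real n"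
  shows "(\<exists>\<Psi>. T2_rep R n k \<beta> \<nu> H \<Psi>) \<longleftrightarrow>
    (\<forall>t::int. - (R * cos (\<alpha> / 2)) < cos (\<beta> - \<alpha> / 2 + 2 * pi * of_int t / real n))"
proof -
  have n: "0 < n" using nk by auto
  have "0 \<le> \<alpha>" "\<alpha> < pi"
    using n nk(3) by (simp_all add: \<alpha> field_simps)
  then have c: "0 < cos (\<alpha> / 2)"
    by (intro cos_gt_zero_pi) auto
  have "(\<exists>\<Psi>. T2_rep R n k \<beta> \<nu> H \<Psi>) \<longleftrightarrow>
      (\<forall>m<n. 0 < inverse (cos (\<alpha> / 2)) * cos (\<beta> - \<alpha> / 2 + real m * \<alpha>) + R)"
  proof
    assume "\<exists>\<Psi>. T2_rep R n k \<beta> \<nu> H \<Psi>"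
    then obtain C :: "nat \<Rightarrow> complex" where "\<forall>m<n. C m \<noteq> 0 \<and>
        (cmod (C m))\<^sup>2 = inverse (cos (\<alpha> / 2)) * cos (\<beta> - \<alpha> / 2 + real m * \<alpha>) + R"
      unfolding T2_rep_def \<alpha> by blast
    then show "\<forall>m<n. 0 < inverse (cos (\<alpha> / 2)) * cos (\<beta> - \<alpha> / 2 + real m * \<alpha>) + R"
      by (metis norm_eq_zero zero_less_power2)
  qed (use T2_rep_exists[OF H nk \<nu> \<alpha>] in blast)
  also have "\<dots> \<longleftrightarrow> (\<forall>m<n. - (R * cos (\<alpha> / 2)) < cos (\<beta> - \<alpha> / 2 + real m * \<alpha>))"
  proof -
    have "0 < inverse (cos (\<alpha> / 2)) * y + R \<longleftrightarrow> - (R * cos (\<alpha> / 2)) < y" for y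
      using c by (simp add: field_simps) linarith
    then show ?thesis by simp
  qed
  also have "\<dots> \<longleftrightarrow> (\<forall>t::int. - (R * cos (\<alpha> / 2)) < cos (\<beta> - \<alpha> / 2 + 2 * pi * of_int t / real n))"
    by (rule all_multiples_iff_all_fractions[OF nk(1) n \<alpha>])
  finally show ?thesis .
qed

text \<open>\<nu> and the space are fixed in advance, so \<beta> is the one parameter left; in the
  middle case the equivalence makes the stated interval exact.\<close>

theorem lemma10:
  fixes R \<alpha> :: real and n k :: nat and \<nu> :: complex
    and H :: "('h::ab_group_add) hspace"
  assumes "coprime n k" and "1 \<le> k" and "real k < real n / 2"
    and "\<alpha> = 2 * pi * real k / real n"
    and "cmod \<nu> = 1"
    and "hilbert_space_dim H n"
  shows "(R < cos (pi / real n) * inverse (cos (pi * real k / real n)) \<longrightarrow>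
            \<not> (\<exists>\<beta> \<Psi>. T2_rep R n k \<beta> \<nu> H \<Psi>)) \<and>
         (cos (pi / real n) * inverse (cos (pi * real k / real n)) < R \<and>
          R \<le> inverse (cos (pi * real k / real n)) \<longrightarrow>
            (\<exists>\<delta>. cos (\<delta> / 2) = R * cos (pi * real k / real n) \<and>
              0 \<le> \<delta> \<and> \<delta> < 2 * pi / real n \<and>
              (\<forall>\<beta>. pi - 2 * pi / real n < \<beta> - \<alpha> / 2 \<and> \<beta> - \<alpha> / 2 \<le> pi \<longrightarrow>
                ((\<exists>\<Psi>. T2_rep R n k \<beta> \<nu> H \<Psi>) \<longleftrightarrow>
                 pi - 2 * pi / real n + \<delta> / 2 < \<beta> - \<alpha> / 2 \<and>
                 \<beta> - \<alpha> / 2 < pi - \<delta> / 2)))) \<and>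
         (inverse (cos (pi * real k / real n)) < R \<longrightarrow>
            (\<forall>\<beta>. pi - 2 * pi / real n < \<beta> - \<alpha> / 2 \<and> \<beta> - \<alpha> / 2 \<le> pi \<longrightarrow>
              (\<exists>\<Psi>. irreducible_rep R H \<Psi> \<and> T2_rep R n k \<beta> \<nu> H \<Psi>)))"
proof -
  have n: "3 \<le> n" using assms(2,3) by linarith
  have half: "\<alpha> / 2 = pi * real k / real n" using assms(4) by simp
  define c where "c = cos (pi * real k / real n)"
  have "pi * real k / real n < pi / 2"
    using n assms(3) by (simp add: field_simps)
  moreover have "0 \<le> pi * real k / real n" by simp
  ultimately have c: "0 < c"
    unfolding c_def using pi_gt_zero by (intro cos_gt_zero_pi) linarith+
  have iff: "(\<exists>\<Psi>. T2_rep R n k \<beta> \<nu> H \<Psi>) \<longleftrightarrow>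
    (\<forall>t::int. - (R * c) < cos (\<beta> - \<alpha> / 2 + 2 * pi * of_int t / real n))" for \<beta>
    using T2_rep_exists_iff[OF assms(6,1,2,3,5,4), of R \<beta>] by (simp only: half c_def)
  have "\<not> (\<exists>\<beta> \<Psi>. T2_rep R n k \<beta> \<nu> H \<Psi>)" if "R < cos (pi / real n) * inverse c"
  proof
    assume "\<exists>\<beta> \<Psi>. T2_rep R n k \<beta> \<nu> H \<Psi>"
    then obtain \<beta> where *: "\<forall>t::int. - (R * c) < cos (\<beta> - \<alpha> / 2 + 2 * pi * of_int t / real n)"
      using iff by blast
    obtain t :: int where "cos (\<beta> - \<alpha> / 2 + 2 * pi * of_int t / real n) \<le> - cos (pi / real n)"
      using exists_angle_near_pi n by (metis not_gr0 not_numeral_le_zero)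
    moreover have "R * c < cos (pi / real n)" using that c by (simp add: field_simps)
    ultimately show False using *[rule_format, of t] by linarith
  qed
  moreover have "\<exists>\<delta>. cos (\<delta> / 2) = R * c \<and> 0 \<le> \<delta> \<and> \<delta> < 2 * pi / real n \<and>
      (\<forall>\<beta>. pi - 2 * pi / real n < \<beta> - \<alpha> / 2 \<and> \<beta> - \<alpha> / 2 \<le> pi \<longrightarrow>
        ((\<exists>\<Psi>. T2_rep R n k \<beta> \<nu> H \<Psi>) \<longleftrightarrow>
          pi - 2 * pi / real n + \<delta> / 2 < \<beta> - \<alpha> / 2 \<and> \<beta> - \<alpha> / 2 < pi - \<delta> / 2))"
    if R: "cos (pi / real n) * inverse c < R" "R \<le> inverse c"
  proof -
    \<comment> \<open>\<open>D\<close> is \<delta>/2, the half-width of the forbidden arc. R c >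
      cos(pi/n) says that it is smaller than half the spacing of the angles.\<close>
    define D where "D = arccos (R * c)"
    have Rc: "cos (pi / real n) < R * c" "R * c \<le> 1"
      using R c by (simp_all add: field_simps)
    then have Rc': "- 1 \<le> R * c" using cos_ge_minus_one[of "pi / real n"] by linarith
    have cosD: "cos D = R * c"
      using Rc Rc' by (simp add: D_def)
    have D0: "0 \<le> D" "D \<le> pi"
      using Rc Rc' by (simp_all add: D_def arccos_lbound arccos_ubound)
    have Dn: "D < pi / real n"
    proof (rule ccontr)
      assume "\<not> D < pi / real n"
      then have "cos D \<le> cos (pi / real n)"
        using D0 by (intro cos_monotone_0_pi_le) auto
      then show False using cosD Rc by simp
    qed
    show ?thesis
      using all_fractions_avoid_arc_iff[OF n D0(1) Dn] cosD D0 Dn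
      by (intro exI[of _ "2 * D"]) (simp add: iff)
  qed
  moreover have "\<exists>\<Psi>. irreducible_rep R H \<Psi> \<and> T2_rep R n k \<beta> \<nu> H \<Psi>" if "inverse c < R" for \<beta>
  proof -
    \<comment> \<open>Now -(R c) lies below every cosine, so the forbidden arc is empty and no phase
      is excluded.\<close>
    have "1 < R * c" using that c by (simp add: field_simps)
    then have "- (R * c) < cos y" for y
      using cos_ge_minus_one[of y] by linarith
    then obtain \<Psi> where "T2_rep R n k \<beta> \<nu> H \<Psi>"
      using iff by blast
    then show ?thesis
      unfolding T2_rep_def admissible_rep_def by blast
  qed
  ultimately show ?thesis
    unfolding c_def by blast
qed

end
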